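(* Let $n$ be a positive integer and let $D_{2n}$ be the dihedral group of order $2n$. The number of exact factorizations of $D_{2n}$ is given by the following expressions: \begin{enumerate} \item $f_2(D_{2n})=2^{\omega(n)}-1$, if $n$ is odd; \item $f_2(D_{2n})=2^{\omega(n)}+2^{\omega\left(\frac{n}{2}\right)-1}+\omega\left(\frac{n}{2}\right)-\omega(n)-1$, if $n$ is even. \end{enumerate}
   Context: $\omega(m)$ denotes the number of (distinct) prime divisors of $m$. $D_{2n}=\langle r,s\mid r^n=s^2=e,\ rs=sr^{-1}\rangle$. An exact factorization of a finite group $G$ is a pair $(H,K)$ of subgroups of $G$ with $G=HK$ and $H\cap K=1$; in counting, only factorizations in which both $H$ and $K$ are nontrivial are considered. Two exact factorizations $(H,K)$ and $(L,M)$ of $G$ are equivalent if either $H\cong L$ and $K\cong M$, or $H\cong M$ and $K\cong L$ (abstract group isomorphisms). $f_2(G)$ denotes the number of equivalence classes of exact factorizations of $G$.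
   Formalization: For n = 2 the printed formula gives 1/2, whereas D_4 = C_2 × C_2 has exactly one class; so part 2 is proved for every even n other than 2, and the correct value f_2(D_4) = 1 is proved separately. *)

theory Defs
  imports Complex_Main "HOL-Algebra.Coset" "HOL-Computational_Algebra.Primes"
begin

definition prime_omega :: "nat \<Rightarrow> nat" where
  "prime_omega m = card {p. prime p \<and> p dvd m}"


(* The letter (x, True) stands for the generator x, (x, False) for its
   inverse, and a relation u = v is the pair (u, v) of words. *)

type_synonym 'a gword = "('a \<times> bool) list"

inductive pres_eq :: "('a gword \<times> 'a gword) set \<Rightarrow> 'a gword \<Rightarrow> 'a gword \<Rightarrow> bool"
  for R where
  refl: "pres_eq R w w"
| sym: "pres_eq R v w \<Longrightarrow> pres_eq R w v"
| trans: "pres_eq R u v \<Longrightarrow> pres_eq R v w \<Longrightarrow> pres_eq R u w"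
| cancel: "pres_eq R (u @ [(x, b), (x, \<not> b)] @ v) (u @ v)"
| relator: "(l, r) \<in> R \<Longrightarrow> pres_eq R (u @ l @ v) (u @ r @ v)"

definition pres_rel :: "('a gword \<times> 'a gword) set \<Rightarrow> ('a gword \<times> 'a gword) set" where
  "pres_rel R = {(u, v). pres_eq R u v}"

definition presented_group :: "('a gword \<times> 'a gword) set \<Rightarrow> 'a gword set monoid" where
  "presented_group R =
    \<lparr>carrier = UNIV // pres_rel R,
     monoid.mult = (\<lambda>A B. \<Union>a\<in>A. \<Union>b\<in>B. pres_rel R `` {a @ b}),
     monoid.one = pres_rel R `` {[]}\<rparr>"

datatype dihedral_gen = Rot | Refl

definition dihedral_group :: "nat \<Rightarrow> dihedral_gen gword set monoid" where
  "dihedral_group n = presented_group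
    {(replicate n (Rot, True), []),
     ([(Refl, True), (Refl, True)], []),
     ([(Rot, True), (Refl, True)], [(Refl, True), (Rot, False)])}"


definition exact_factorization :: "('a, 'b) monoid_scheme \<Rightarrow> 'a set \<Rightarrow> 'a set \<Rightarrow> bool" where
  "exact_factorization G H K \<longleftrightarrow>
    subgroup H G \<and> subgroup K G \<and> H <#>\<^bsub>G\<^esub> K = carrier G \<and> H \<inter> K = {\<one>\<^bsub>G\<^esub>}"

definition nontrivial_exact_factorizations ::
    "('a, 'b) monoid_scheme \<Rightarrow> ('a set \<times> 'a set) set" where
  "nontrivial_exact_factorizations G =
    {(H, K). exact_factorization G H K \<and> H \<noteq> {\<one>\<^bsub>G\<^esub>} \<and> K \<noteq> {\<one>\<^bsub>G\<^esub>}}"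

definition factorization_equiv ::
    "('a, 'b) monoid_scheme \<Rightarrow> 'a set \<times> 'a set \<Rightarrow> 'a set \<times> 'a set \<Rightarrow> bool" where
  "factorization_equiv G = (\<lambda>(H, K) (L, M).
    (G\<lparr>carrier := H\<rparr> \<cong> G\<lparr>carrier := L\<rparr> \<and> G\<lparr>carrier := K\<rparr> \<cong> G\<lparr>carrier := M\<rparr>) \<or>
    (G\<lparr>carrier := H\<rparr> \<cong> G\<lparr>carrier := M\<rparr> \<and> G\<lparr>carrier := K\<rparr> \<cong> G\<lparr>carrier := L\<rparr>))"

definition f2 :: "('a, 'b) monoid_scheme \<Rightarrow> nat" where
  "f2 G = card (nontrivial_exact_factorizations G //
    {(p, q). p \<in> nontrivial_exact_factorizations G \<and> q \<in> nontrivial_exact_factorizations G \<and>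
             factorization_equiv G p q})"


lemma pres_eq_context: "pres_eq R u v \<Longrightarrow> pres_eq R (a @ u @ b) (a @ v @ b)"
proof (induction rule: pres_eq.induct)
  case (cancel u x c v)
  show ?case using pres_eq.cancel[of R "a @ u" x c "v @ b"] by simp
next
  case (relator l r u v)
  show ?case using pres_eq.relator[OF relator, of "a @ u" "v @ b"] by simp
next
  case (trans u v w)
  show ?case using trans.IH by (rule pres_eq.trans)
qed (rule pres_eq.refl, rule pres_eq.sym)

lemma pres_eq_append: "pres_eq R u u' \<Longrightarrow> pres_eq R v v' \<Longrightarrow> pres_eq R (u @ v) (u' @ v')"
  using pres_eq.trans[of R "u @ v" "u' @ v" "u' @ v'"]
    pres_eq_context[of R u u' "[]" v] pres_eq_context[of R v v' u' "[]"]
  by simp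

lemma equiv_pres_rel: "equiv UNIV (pres_rel R)"
proof (rule equivI)
  show "refl_on UNIV (pres_rel R)" by (simp add: refl_on_def pres_rel_def pres_eq.refl)
  show "sym (pres_rel R)" by (rule symI) (simp add: pres_rel_def, erule pres_eq.sym)
  show "trans (pres_rel R)" by (rule transI) (simp add: pres_rel_def, erule (1) pres_eq.trans)
qed simp

lemma pres_class_eq_iff: "pres_rel R `` {u} = pres_rel R `` {v} \<longleftrightarrow> pres_eq R u v"
  using eq_equiv_class_iff[OF equiv_pres_rel, of u v R] by (simp add: pres_rel_def)

lemma presented_group_mult:
  "(pres_rel R `` {u}) \<otimes>\<^bsub>presented_group R\<^esub> (pres_rel R `` {v}) = pres_rel R `` {u @ v}"
proof -
  have "pres_rel R `` {a @ b} = pres_rel R `` {u @ v}"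
    if "a \<in> pres_rel R `` {u}" "b \<in> pres_rel R `` {v}" for a b
    unfolding pres_class_eq_iff
    by (rule pres_eq.sym, rule pres_eq_append) (use that in \<open>simp_all add: pres_rel_def\<close>)
  moreover have "u \<in> pres_rel R `` {u}" "v \<in> pres_rel R `` {v}"
    by (simp_all add: pres_rel_def pres_eq.refl)
  ultimately have "(\<Union>a\<in>pres_rel R `` {u}. \<Union>b\<in>pres_rel R `` {v}. pres_rel R `` {a @ b}) =
      pres_rel R `` {u @ v}"
    by (intro SUP_eq_const) (assumption | force)+
  then show ?thesis by (simp add: presented_group_def)
qed

lemma pres_inverse: "\<exists>w'. pres_eq R (w' @ w) []"
proof (induction w)
  case Nil
  show ?case by (intro exI[of _ "[]"]) (simp add: pres_eq.refl)
next
  case (Cons c w)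
  then obtain w' where w': "pres_eq R (w' @ w) []" by blast
  obtain x b where c: "c = (x, b)" by (cases c)
  have "pres_eq R ((w' @ [(x, \<not> b)]) @ c # w) (w' @ w)"
    using pres_eq.cancel[of R w' x "\<not> b" w] c by simp
  from pres_eq.trans[OF this w'] show ?case by (rule exI)
qed

lemma group_presented_group: "group (presented_group R)"
proof (rule groupI)
  let ?G = "presented_group R"
  have carr: "carrier ?G = range (\<lambda>w. pres_rel R `` {w})"
    by (auto simp: presented_group_def quotient_def)
  have one: "\<one>\<^bsub>?G\<^esub> = pres_rel R `` {[]}" by (simp add: presented_group_def)
  show "\<one>\<^bsub>?G\<^esub> \<in> carrier ?G" by (auto simp: carr one)
  show "x \<otimes>\<^bsub>?G\<^esub> y \<in> carrier ?G" if "x \<in> carrier ?G" "y \<in> carrier ?G" for x y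
    using that by (auto simp: carr presented_group_mult)
  show "x \<otimes>\<^bsub>?G\<^esub> y \<otimes>\<^bsub>?G\<^esub> z = x \<otimes>\<^bsub>?G\<^esub> (y \<otimes>\<^bsub>?G\<^esub> z)"
    if "x \<in> carrier ?G" "y \<in> carrier ?G" "z \<in> carrier ?G" for x y z
    using that by (auto simp: carr presented_group_mult)
  show "\<one>\<^bsub>?G\<^esub> \<otimes>\<^bsub>?G\<^esub> x = x" if "x \<in> carrier ?G" for x
    using that by (auto simp: carr one presented_group_mult)
  show "\<exists>y\<in>carrier ?G. y \<otimes>\<^bsub>?G\<^esub> x = \<one>\<^bsub>?G\<^esub>" if x: "x \<in> carrier ?G" for x
  proof -
    obtain w where w: "x = pres_rel R `` {w}" using x by (auto simp: carr)
    obtain w' where "pres_eq R (w' @ w) []" using pres_inverse by blast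
    then have "(pres_rel R `` {w'}) \<otimes>\<^bsub>?G\<^esub> x = \<one>\<^bsub>?G\<^esub>"
      by (simp add: w one presented_group_mult pres_class_eq_iff)
    then show ?thesis by (auto simp: carr)
  qed
qed

end

theory Submission
  imports Defs
begin

text \<open>Every subgroup of the dihedral group is \<open>\<langle>r\<^sup>a\<rangle>\<close> or \<open>\<langle>r\<^sup>a, r\<^sup>j s\<rangle>\<close> with \<open>a\<close> dividing \<open>n\<close>, and its isomorphism
  type is determined by its order and by whether it is cyclic. The subgroups \<open>\<langle>r\<^sup>a\<rangle>\<close> and \<open>\<langle>r\<^sup>b, r\<^sup>j s\<rangle>\<close>
  factorize the group exactly iff \<open>a\<close> and \<open>b\<close> are coprime with \<open>a b = n\<close>, and \<open>\<langle>r\<^sup>a, r\<^sup>i s\<rangle>\<close> and \<open>\<langle>r\<^sup>b, r\<^sup>j s\<rangle>\<close> do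
  iff \<open>gcd a b = 2\<close>, \<open>lcm a b = n\<close> and \<open>i - j\<close> is odd. The first kind gives one class for each unitary divisor
  \<open>b \<noteq> 1\<close> of \<open>n\<close>; the second gives one for each unordered coprime factorization of \<open>n / 2\<close>. Exactly one
  class, with factors of order \<open>2\<close> and \<open>n\<close>, is counted twice, namely when \<open>n / 2\<close> is odd; this is
  the correction \<open>\<omega>(n / 2) - \<omega>(n)\<close>.\<close>

section \<open>Unitary divisors\<close>

definition unitary_divisors :: "nat \<Rightarrow> nat set" where
  "unitary_divisors m = {d. d dvd m \<and> coprime d (m div d)}"

lemma finite_unitary_divisors: "m > 0 \<Longrightarrow> finite (unitary_divisors m)"
  by (simp add: unitary_divisors_def)

lemma unitary_divisors_mult_div: "d \<in> unitary_divisors m \<Longrightarrow> d * (m div d) = m"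
  by (simp add: unitary_divisors_def)

lemma unitary_divisors_complement:
  "m > 0 \<Longrightarrow> d \<in> unitary_divisors m \<Longrightarrow> m div d \<in> unitary_divisors m"
  by (auto simp: unitary_divisors_def coprime_commute div_dvd_iff_mult elim!: dvdE)

lemma div_div_unitary: "m > 0 \<Longrightarrow> d \<in> unitary_divisors m \<Longrightarrow> m div (m div d) = d"
  by (auto simp: unitary_divisors_def elim!: dvdE)

lemma unitary_divisors_iff:
  "m > 0 \<Longrightarrow> d \<in> unitary_divisors m \<longleftrightarrow> (\<exists>e. d * e = m \<and> coprime d e)"
  by (auto simp: unitary_divisors_def elim!: dvdE)

text \<open>A prime of \<open>d\<close> cannot divide the coprime cofactor, so the full power of
  \<open>p\<close> in \<open>m\<close> already lies in \<open>d\<close>.\<close>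

lemma multiplicity_unitary_divisor:
  assumes m: "m > 0" and d: "d \<in> unitary_divisors m" and p: "prime p" "p dvd d"
  shows "multiplicity p d = multiplicity p m"
proof -
  have e: "m = d * (m div d)" and "coprime d (m div d)"
    using d by (auto simp: unitary_divisors_def)
  then have "\<not> p dvd m div d" using p coprime_common_divisor not_prime_unit by blast
  moreover have "d \<noteq> 0" "m div d \<noteq> 0" using e m by (metis mult_0 less_irrefl, metis mult_0_right less_irrefl)
  then have "multiplicity p (d * (m div d)) = multiplicity p d + multiplicity p (m div d)"
    using p by (intro prime_elem_multiplicity_mult_distrib) auto
  ultimately show ?thesis using e by (simp add: not_dvd_imp_multiplicity_0)
qed

lemma prime_factors_nat_eq: "m > 0 \<Longrightarrow> prime_factors m = {p::nat. prime p \<and> p dvd m}"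
  by (auto simp: prime_factors_dvd)

text \<open>A unitary divisor takes each prime power of \<open>m\<close> entirely or not at all, so
  choosing one amounts to choosing a set of primes.\<close>

lemma bij_betw_unitary_divisors:
  assumes m: "m > 0"
  shows "bij_betw (\<lambda>d. {p. prime p \<and> p dvd d}) (unitary_divisors m)
           (Pow {p. prime p \<and> p dvd m})"
proof (rule bij_betw_imageI)
  show "inj_on (\<lambda>d. {p. prime p \<and> p dvd d}) (unitary_divisors m)"
  proof (rule inj_onI)
    fix d e assume d: "d \<in> unitary_divisors m" and e: "e \<in> unitary_divisors m"
      and eq: "{p. prime p \<and> p dvd d} = {p. prime p \<and> p dvd e}"
    have pos: "d > 0" "e > 0" using d e m by (auto simp: unitary_divisors_def intro: Nat.gr0I)
    show "d = e"
    proof (rule multiplicity_eq_nat[OF pos])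
      fix p :: nat assume p: "prime p"
      have iff: "p dvd d \<longleftrightarrow> p dvd e" using eq p by blast
      show "multiplicity p d = multiplicity p e"
      proof (cases "p dvd d")
        case True
        then show ?thesis using iff multiplicity_unitary_divisor[OF m d p] multiplicity_unitary_divisor[OF m e p] by simp
      next
        case False
        then show ?thesis using iff by (simp add: not_dvd_imp_multiplicity_0)
      qed
    qed
  qed
  show "(\<lambda>d. {p. prime p \<and> p dvd d}) ` unitary_divisors m = Pow {p. prime p \<and> p dvd m}"
  proof (intro equalityI subsetI)
    fix P assume "P \<in> Pow {p. prime p \<and> p dvd m}"
    then have P: "P \<subseteq> prime_factors m" using m by (simp add: prime_factors_nat_eq)
    then have fin: "finite P" by (rule finite_subset) simp
    have prime: "prime p" if "p \<in> prime_factors m" for p using that by auto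
    \<comment> \<open>\<open>d\<close> collects the full prime powers of \<open>m\<close> at the
      primes in \<open>P\<close>, and \<open>e\<close> the remaining ones.\<close>
    define d where "d = (\<Prod>p\<in>P. p ^ multiplicity p m)"
    define e where "e = (\<Prod>p\<in>prime_factors m - P. p ^ multiplicity p m)"
    have "d * e = m"
      unfolding d_def e_def using prod.subset_diff[OF P, of "\<lambda>p. p ^ multiplicity p m"] m
      by (simp add: prime_factorization_nat[symmetric] mult.commute)
    moreover have "coprime d e"
      unfolding d_def e_def
    proof (intro prod_coprime_left prod_coprime_right)
      fix p q assume "p \<in> P" "q \<in> prime_factors m - P"
      then have "prime p" "prime q" "p \<noteq> q" using P prime by auto
      then show "coprime (p ^ multiplicity p m) (q ^ multiplicity q m)"
        by (simp add: primes_coprime)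
    qed
    ultimately have "d \<in> unitary_divisors m" using m by (auto simp: unitary_divisors_iff)
    moreover have "{p. prime p \<and> p dvd d} = P"
    proof (intro equalityI subsetI)
      fix p assume "p \<in> {p. prime p \<and> p dvd d}"
      then obtain q where "prime p" "q \<in> P" "p dvd q ^ multiplicity q m"
        using fin by (auto simp: d_def prime_dvd_prod_iff)
      moreover from this have "p dvd q" using prime_dvd_power by blast
      ultimately show "p \<in> P" using P prime[of q] primes_dvd_imp_eq[of p q] by auto
    next
      fix p assume p: "p \<in> P"
      then have "multiplicity p m > 0" "prime p" using P by (auto simp: prime_factors_multiplicity)
      then have "p dvd p ^ multiplicity p m" by simp
      also have "\<dots> dvd d" unfolding d_def using p fin by (intro dvd_prodI)
      finally show "p \<in> {p. prime p \<and> p dvd d}" using \<open>prime p\<close> by simp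
    qed
    ultimately show "P \<in> (\<lambda>d. {p. prime p \<and> p dvd d}) ` unitary_divisors m" by blast
  next
    fix P assume "P \<in> (\<lambda>d. {p. prime p \<and> p dvd d}) ` unitary_divisors m"
    then obtain d where "d dvd m" "P = {p. prime p \<and> p dvd d}" by (auto simp: unitary_divisors_def)
    then show "P \<in> Pow {p. prime p \<and> p dvd m}" using dvd_trans by blast
  qed
qed

lemma card_unitary_divisors: "m > 0 \<Longrightarrow> card (unitary_divisors m) = 2 ^ prime_omega m"
  using bij_betw_same_card[OF bij_betw_unitary_divisors]
  by (simp add: card_Pow prime_omega_def flip: prime_factors_nat_eq)

text \<open>Passing to the complementary divisor is an involution without fixed points, so the
  unordered pairs cut the unitary divisors into blocks of size two. For \<open>m = 1\<close> the
  divisor 1 is fixed, which is why the case \<open>n = 2\<close> of the final count stands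
  apart.\<close>

lemma card_unordered_unitary_divisors:
  assumes m: "m > 1"
  shows "2 * card ((\<lambda>d. {d, m div d}) ` unitary_divisors m) = 2 ^ prime_omega m"
proof -
  let ?C = "(\<lambda>d. {d, m div d}) ` unitary_divisors m"
  have union: "\<Union>?C = unitary_divisors m" using unitary_divisors_complement m by auto
  have "2 * card ?C = card (\<Union>?C)"
  proof (rule card_partition)
    show "finite ?C" "finite (\<Union>?C)"
      using finite_unitary_divisors[of m] m unfolding union by auto
    show "card c = 2" if "c \<in> ?C" for c
    proof -
      obtain d where d: "d \<in> unitary_divisors m" "c = {d, m div d}" using \<open>c \<in> ?C\<close> by auto
      have "d \<noteq> m div d"
      proof
        assume "d = m div d"
        then have "coprime d d" "d * d = m"
          using d unitary_divisors_mult_div[OF d(1)] by (auto simp: unitary_divisors_def)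
        then show False using m by simp
      qed
      then show ?thesis using d by simp
    qed
    show "c \<inter> c' = {}" if "c \<in> ?C" "c' \<in> ?C" "c \<noteq> c'" for c c'
    proof -
      obtain d where d: "d \<in> unitary_divisors m" "c = {d, m div d}" using \<open>c \<in> ?C\<close> by auto
      obtain e where e: "e \<in> unitary_divisors m" "c' = {e, m div e}" using \<open>c' \<in> ?C\<close> by auto
      have "m div (m div d) = d" "m div (m div e) = e" using d e div_div_unitary m by auto
      then show ?thesis using \<open>c \<noteq> c'\<close> d e by auto
    qed
  qed
  then show ?thesis using union card_unitary_divisors m by simp
qed

section \<open>Auxiliary facts on counting and congruences\<close>

lemma prime_omega_double:
  assumes "m > 0"
  shows "prime_omega (2 * m) = prime_omega m + (if odd m then 1 else 0)"
proof -
  have "{p. prime p \<and> p dvd 2 * m} = insert 2 {p. prime p \<and> p dvd m}"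
    by (auto simp: prime_dvd_mult_iff primes_dvd_imp_eq)
  moreover have "finite {p. prime p \<and> p dvd m}" using assms by simp
  ultimately show ?thesis by (auto simp: prime_omega_def card_insert_if)
qed

text \<open>The classes are the nonempty fibres of \<open>f\<close>. With a complete invariant as
  \<open>f\<close>, counting classes becomes counting values.\<close>

lemma card_quotient_eq_card_image:
  "card (A // {(p, q). p \<in> A \<and> q \<in> A \<and> f p = f q}) = card (f ` A)"
proof -
  let ?E = "{(p, q). p \<in> A \<and> q \<in> A \<and> f p = f q}"
  have "inj_on (\<lambda>v. {x \<in> A. f x = v}) (f ` A)" by (rule inj_onI) blast
  moreover have "?E `` {x} = {y \<in> A. f y = f x}" if "x \<in> A" for x using that by auto
  then have "A // ?E = (\<lambda>v. {x \<in> A. f x = v}) ` f ` A" by (auto simp: quotient_def)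
  ultimately show ?thesis by (simp add: card_image)
qed

text \<open>Chinese remainder theorem for moduli that need not be coprime. Bezout splits
  \<open>s - t\<close> into a multiple of \<open>a\<close> and a multiple of \<open>b\<close>;
  subtracting the first from \<open>s\<close> gives a solution.\<close>

lemma ex_int_simultaneous_congruence:
  "(\<exists>x. int a dvd x - s \<and> int b dvd x - t) \<longleftrightarrow> int (gcd a b) dvd s - t"
proof
  assume "\<exists>x. int a dvd x - s \<and> int b dvd x - t"
  then obtain x where "int (gcd a b) dvd x - s" "int (gcd a b) dvd x - t"
    by (meson dvd_trans gcd_dvd1 gcd_dvd2 int_dvd_int_iff)
  from dvd_diff[OF this(2,1)] show "int (gcd a b) dvd s - t" by simp
next
  assume "int (gcd a b) dvd s - t"
  then obtain q where q: "s - t = int (gcd a b) * q" by auto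
  obtain u v where "u * int a + v * int b = gcd (int a) (int b)" using bezout_int by blast
  then have "s - t = (u * int a + v * int b) * q" using q by simp
  then have "s - int a * (u * q) - t = int b * (v * q)" by (simp add: algebra_simps)
  then have "int b dvd s - int a * (u * q) - t" by simp
  moreover have "int a dvd s - int a * (u * q) - s" by simp
  ultimately show "\<exists>x. int a dvd x - s \<and> int b dvd x - t" by blast
qed

text \<open>The left side is the form in which trivial intersection of the rotation parts of two
  subgroups appears.\<close>

lemma common_multiples_iff_lcm:
  assumes "a dvd n" "b dvd n"
  shows "(\<forall>i. int a dvd i \<and> int b dvd i \<longrightarrow> int n dvd i) \<longleftrightarrow> lcm a b = n"
proof
  assume "\<forall>i. int a dvd i \<and> int b dvd i \<longrightarrow> int n dvd i"
  from this[THEN spec, of "int (lcm a b)"] have "n dvd lcm a b" by simp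
  with assms show "lcm a b = n" by (simp add: dvd_antisym)
next
  assume "lcm a b = n"
  then have "int n = lcm (int a) (int b)" by simp
  then show "\<forall>i. int a dvd i \<and> int b dvd i \<longrightarrow> int n dvd i" by (metis lcm_least)
qed

section \<open>Products of subgroups and subgroups of order two in an arbitrary group\<close>

context group
begin

text \<open>Solving \<open>g = h \<otimes> k\<close> for \<open>k\<close> leaves one existential,
  which for rotations and reflections becomes a pair of congruences.\<close>

lemma set_mult_mem_iff:
  assumes "H \<subseteq> carrier G" "K \<subseteq> carrier G" "g \<in> carrier G"
  shows "g \<in> H <#> K \<longleftrightarrow> (\<exists>h\<in>H. inv h \<otimes> g \<in> K)"
proof
  assume "g \<in> H <#> K"
  then obtain h k where "h \<in> H" "k \<in> K" "g = h \<otimes> k" by (auto simp: set_mult_def)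
  then show "\<exists>h\<in>H. inv h \<otimes> g \<in> K"
    using assms by (intro bexI[of _ h]) (auto simp: m_assoc[symmetric] subset_iff)
next
  assume "\<exists>h\<in>H. inv h \<otimes> g \<in> K"
  then obtain h where h: "h \<in> H" "inv h \<otimes> g \<in> K" by auto
  then have "h \<in> carrier G" using assms by auto
  then have "g = h \<otimes> (inv h \<otimes> g)" using assms by (simp add: m_assoc[symmetric])
  then show "g \<in> H <#> K" using h unfolding set_mult_def by blast
qed

text \<open>Inversion turns a factorization \<open>h \<otimes> k\<close> of \<open>inv g\<close>
  into a factorization of \<open>g\<close> in the opposite order.\<close>

lemma exact_factorization_commute:
  assumes "exact_factorization G H K"
  shows "exact_factorization G K H"
proof -
  have sub: "subgroup H G" "subgroup K G" and prod: "H <#> K = carrier G"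
    and int: "H \<inter> K = {\<one>}"
    using assms by (auto simp: exact_factorization_def)
  have "g \<in> K <#> H" if g: "g \<in> carrier G" for g
  proof -
    have "inv g \<in> H <#> K" using g prod by simp
    then obtain h k where hk: "h \<in> H" "k \<in> K" "inv g = h \<otimes> k" by (auto simp: set_mult_def)
    then have "h \<in> carrier G" "k \<in> carrier G" using sub subgroup.mem_carrier by metis+
    then have "g = inv k \<otimes> inv h" using hk g by (metis inv_inv inv_mult_group)
    moreover have "inv k \<in> K" "inv h \<in> H" using hk sub by (auto intro: subgroup.m_inv_closed)
    ultimately show ?thesis unfolding set_mult_def by blast
  qed
  moreover have "K <#> H \<subseteq> carrier G"
    using sub[THEN subgroup.subset] by (rule set_mult_closed[rotated])
  ultimately show ?thesis using sub int by (auto simp: exact_factorization_def)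
qed

text \<open>In a dihedral group such a subgroup may be generated by a rotation or by a reflection;
  this lemma identifies the two cases.\<close>

lemma iso_subgroups_card_2:
  assumes H: "subgroup H G" "card H = 2" and L: "subgroup L G" "card L = 2"
  shows "G\<lparr>carrier := H\<rparr> \<cong> G\<lparr>carrier := L\<rparr>"
proof -
  have *: "\<exists>x. x \<in> carrier G \<and> x \<noteq> \<one> \<and> x \<otimes> x = \<one> \<and> M = {\<one>, x}"
    if M: "subgroup M G" "card M = 2" for M
  proof -
    interpret M: subgroup M G by (rule M)
    obtain x where x: "M = {\<one>, x}" "x \<noteq> \<one>"
      using M(2) M.one_closed by (metis card_2_iff insertE insert_commute singletonD)
    then have xG: "x \<in> carrier G" using M.subset by auto
    \<comment> \<open>The only idempotent of a group is the identity, so closure of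
      \<open>{\<one>, x}\<close> forces \<open>x \<otimes> x = \<one>\<close>.\<close>
    then have "x \<otimes> x \<noteq> x" using x l_cancel_one[of x x] by auto
    moreover have "x \<otimes> x \<in> M" using x by (intro M.m_closed) auto
    ultimately show ?thesis using x xG by (intro exI[of _ x]) auto
  qed
  obtain x where x: "x \<in> carrier G" "x \<noteq> \<one>" "x \<otimes> x = \<one>" "H = {\<one>, x}"
    using *[OF H] by auto
  obtain y where y: "y \<in> carrier G" "y \<noteq> \<one>" "y \<otimes> y = \<one>" "L = {\<one>, y}"
    using *[OF L] by auto
  have "(\<lambda>g. if g = \<one> then \<one> else y) \<in> iso (G\<lparr>carrier := H\<rparr>) (G\<lparr>carrier := L\<rparr>)"
    using x y by (auto simp: iso_def hom_def bij_betw_def inj_on_def)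
  then show ?thesis by (rule is_isoI)
qed

end

section \<open>Subgroups and exact factorizations\<close>

text \<open>\<^term>\<open>rot i\<close> is \<open>r\<^sup>i\<close> and \<^term>\<open>refl i\<close> is \<open>r\<^sup>i s\<close>; integer exponents, read modulo \<open>n\<close>,
  avoid truncated subtraction.\<close>

locale dihedral = group G for G (structure) +
  fixes n :: nat and rot refl :: "int \<Rightarrow> 'a"
  assumes n_pos: "n > 0"
    and carrier_eq: "carrier G = range rot \<union> range refl"
    and rot_rot: "rot i \<otimes> rot j = rot (i + j)"
    and rot_refl: "rot i \<otimes> refl j = refl (i + j)"
    and refl_rot: "refl i \<otimes> rot j = refl (i - j)"
    and refl_refl: "refl i \<otimes> refl j = rot (i - j)"
    and rot_eq_iff: "rot i = rot j \<longleftrightarrow> int n dvd i - j"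
    and refl_eq_iff: "refl i = refl j \<longleftrightarrow> int n dvd i - j"
    and rot_neq_refl: "rot i \<noteq> refl j"
begin

lemmas mult_table = rot_rot rot_refl refl_rot refl_refl

lemma rot_closed [simp]: "rot i \<in> carrier G" and refl_closed [simp]: "refl i \<in> carrier G"
  by (auto simp: carrier_eq)

lemma one_eq: "\<one> = rot 0"
  using l_cancel_one[of "rot 0" "rot 0"] by (simp add: rot_rot)

lemma inv_rot: "inv (rot i) = rot (- i)" and inv_refl: "inv (refl i) = refl i"
  by (rule inv_equality; simp add: mult_table one_eq)+

text \<open>The subgroups generated by \<open>r\<^sup>a\<close>, respectively by \<open>r\<^sup>a\<close> and \<open>r\<^sup>j s\<close>.\<close>

definition rots :: "nat \<Rightarrow> 'a set" where
  "rots a = rot ` {i. int a dvd i}"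

definition dih :: "nat \<Rightarrow> int \<Rightarrow> 'a set" where
  "dih a j = rots a \<union> refl ` {i. int a dvd i - j}"

lemma refl_neq_rot: "refl i \<noteq> rot j"
  using rot_neq_refl[of j i] by auto

text \<open>Exponents matter only modulo \<open>n\<close>; as \<open>a\<close> divides
  \<open>n\<close>, divisibility by \<open>a\<close> does not depend on the chosen exponent.\<close>

lemma dvd_transfer: "a dvd n \<Longrightarrow> int n dvd x - y \<Longrightarrow> int a dvd y \<Longrightarrow> int a dvd x"
  using dvd_add[of "int a" "x - y" y] dvd_trans[of "int a" "int n" "x - y"] by simp

lemma rot_in_rots: "a dvd n \<Longrightarrow> rot i \<in> rots a \<longleftrightarrow> int a dvd i"
  using dvd_transfer[of a i] by (force simp: rots_def rot_eq_iff)

lemma refl_notin_rots: "refl i \<notin> rots a"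
  by (auto simp: rots_def refl_neq_rot)

lemma rot_in_dih: "a dvd n \<Longrightarrow> rot i \<in> dih a j \<longleftrightarrow> int a dvd i"
  by (auto simp: dih_def rot_in_rots rot_neq_refl)

lemma refl_in_dih:
  assumes a: "a dvd n"
  shows "refl i \<in> dih a j \<longleftrightarrow> int a dvd i - j"
proof
  assume "refl i \<in> dih a j"
  then obtain k where "int n dvd i - k" "int a dvd k - j"
    by (auto simp: dih_def refl_notin_rots refl_eq_iff)
  then show "int a dvd i - j" using dvd_transfer[OF a, of "i - j" "k - j"] by simp
qed (auto simp: dih_def)

lemmas mem_simps = rot_in_rots refl_notin_rots rot_in_dih refl_in_dih

lemma subset_carrier [simp]: "rots a \<subseteq> carrier G" "dih a j \<subseteq> carrier G"
  by (auto simp: rots_def dih_def)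

lemma carrier_cases [consumes 1, case_names rot refl]:
  assumes "x \<in> carrier G"
  obtains i where "x = rot i" | i where "x = refl i"
  using assms unfolding carrier_eq by blast

lemma set_eqI_dihedral:
  assumes "H \<subseteq> carrier G" "K \<subseteq> carrier G"
    and "\<And>i. rot i \<in> H \<longleftrightarrow> rot i \<in> K" "\<And>i. refl i \<in> H \<longleftrightarrow> refl i \<in> K"
  shows "H = K"
proof -
  have "x \<in> H \<longleftrightarrow> x \<in> K" if "x \<in> carrier G" for x
    using that by (cases x rule: carrier_cases) (simp_all add: assms)
  then show ?thesis using assms(1,2) by blast
qed

lemma subgroup_rots: assumes "a dvd n" shows "subgroup (rots a) G"
proof (rule subgroupI)
  show "rots a \<noteq> {}" using rot_in_rots[OF assms, of 0] by auto
  show "inv x \<in> rots a" if "x \<in> rots a" for x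
  proof -
    obtain i where "x = rot i" "int a dvd i" using \<open>x \<in> rots a\<close> by (auto simp: rots_def)
    then show ?thesis by (simp add: inv_rot rot_in_rots assms)
  qed
  show "x \<otimes> y \<in> rots a" if "x \<in> rots a" "y \<in> rots a" for x y
  proof -
    obtain i where "x = rot i" "int a dvd i" using \<open>x \<in> rots a\<close> by (auto simp: rots_def)
    moreover obtain k where "y = rot k" "int a dvd k" using \<open>y \<in> rots a\<close> by (auto simp: rots_def)
    ultimately show ?thesis by (simp add: rot_rot rot_in_rots assms)
  qed
qed simp

lemma subgroup_dih: assumes a: "a dvd n" shows "subgroup (dih a j) G"
proof (rule subgroupI)
  show "dih a j \<noteq> {}" using rot_in_dih[OF assms, of 0] by auto
  show "inv x \<in> dih a j" if "x \<in> dih a j" for x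
    using subsetD[OF subset_carrier(2) that] that
    by (cases x rule: carrier_cases) (auto simp: inv_rot inv_refl mem_simps a)
  show "x \<otimes> y \<in> dih a j" if x: "x \<in> dih a j" and y: "y \<in> dih a j" for x y
    using subsetD[OF subset_carrier(2) y]
  proof (cases y rule: carrier_cases)
    case (rot k)
    show ?thesis using subsetD[OF subset_carrier(2) x]
    proof (cases x rule: carrier_cases)
      case (refl i)
      then show ?thesis using x y rot dvd_diff[of "int a" "i - j" k]
        by (simp add: mem_simps a mult_table algebra_simps)
    qed (use x y rot in \<open>simp add: mem_simps a mult_table\<close>)
  next
    case (refl k)
    show ?thesis using subsetD[OF subset_carrier(2) x]
    proof (cases x rule: carrier_cases)
      case (rot i)
      then show ?thesis using x y refl dvd_add[of "int a" i "k - j"]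
        by (simp add: mem_simps a mult_table algebra_simps)
    next
      case (refl i)
      then show ?thesis using x y \<open>y = refl k\<close> dvd_diff[of "int a" "i - j" "k - j"]
        by (simp add: mem_simps a mult_table)
    qed
  qed
qed simp

text \<open>The exponents of the rotations in \<open>H\<close> are the multiples of the least
  positive one, \<open>a\<close>. If \<open>H\<close> contains a reflection \<open>refl j\<close>,
  right multiplication by it matches the rotations of \<open>H\<close> with its reflections.\<close>

lemma subgroup_cases:
  assumes H: "subgroup H G"
  obtains a where "a dvd n" "H = rots a" | a j where "a dvd n" "H = dih a j"
proof -
  interpret H: subgroup H G by (rule H)
  define a where "a = (LEAST k::nat. k > 0 \<and> rot (int k) \<in> H)"
  \<comment> \<open>The exponent \<open>n\<close> is a candidate because \<open>rot n\<close> is the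
    identity, so the minimum is attained; it also yields \<open>a dvd n\<close> below.\<close>
  have n: "n > 0 \<and> rot (int n) \<in> H"
    using n_pos H.one_closed rot_eq_iff[of "int n" 0] by (simp add: one_eq)
  have a: "a > 0" "rot (int a) \<in> H"
    using LeastI[of "\<lambda>k. k > 0 \<and> rot (int k) \<in> H", OF n] by (auto simp: a_def)
  have least: "k \<ge> a" if "k > 0" "rot (int k) \<in> H" for k
    unfolding a_def by (rule Least_le) (use that in simp)
  have multiple_nat: "rot (int a * int k) \<in> H" for k
  proof (induction k)
    case 0
    then show ?case using H.one_closed by (simp add: one_eq)
  next
    case (Suc k)
    then show ?case using H.m_closed[OF Suc a(2)] by (simp add: rot_rot algebra_simps)
  qed
  have multiple: "rot (int a * k) \<in> H" for k
  proof (cases "k \<ge> 0")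
    case True
    then show ?thesis using multiple_nat[of "nat k"] by simp
  next
    case False
    then show ?thesis using H.m_inv_closed[OF multiple_nat[of "nat (- k)"]] by (simp add: inv_rot)
  qed
  have rot_iff: "rot i \<in> H \<longleftrightarrow> int a dvd i" for i
  proof
    \<comment> \<open>Division with remainder: \<open>i mod a\<close> is again an exponent of
      \<open>H\<close> but smaller than \<open>a\<close>, hence zero.\<close>
    assume "rot i \<in> H"
    from H.m_closed[OF this multiple[of "- (i div int a)"]]
    have "rot (i mod int a) \<in> H" by (simp add: rot_rot minus_mult_div_eq_mod)
    moreover have "0 \<le> i mod int a" "i mod int a < int a" using a by auto
    ultimately have "i mod int a = 0" using least[of "nat (i mod int a)"] by fastforce
    then show "int a dvd i" by auto
  qed (use multiple in auto)
  have a_dvd: "a dvd n" using n rot_iff by auto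
  show ?thesis
  proof (cases "\<exists>j. refl j \<in> H")
    case True
    then obtain j where j: "refl j \<in> H" by auto
    have "refl i \<in> H \<longleftrightarrow> int a dvd i - j" for i
    proof
      assume "refl i \<in> H"
      from H.m_closed[OF this j] show "int a dvd i - j" by (simp add: refl_refl rot_iff)
    next
      assume "int a dvd i - j"
      then have "rot (i - j) \<in> H" by (simp add: rot_iff)
      from H.m_closed[OF this j] show "refl i \<in> H" by (simp add: rot_refl)
    qed
    then have "H = dih a j"
      by (intro set_eqI_dihedral H.subset subset_carrier) (simp_all add: rot_iff mem_simps a_dvd)
    then show ?thesis using that a_dvd by blast
  next
    case False
    have "H = rots a"
      by (intro set_eqI_dihedral H.subset subset_carrier) (use False in \<open>simp_all add: rot_iff mem_simps a_dvd\<close>)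
    then show ?thesis using that a_dvd by blast
  qed
qed

text \<open>An abstract \<open>f\<close> with an offset \<open>j\<close> serves \<open>rot\<close>
  and \<open>refl\<close> alike. Representatives are \<open>j + a * k\<close> with
  \<open>k < n div a\<close>, the quotient being reduced modulo \<open>n div a\<close>.\<close>

lemma card_multiples:
  assumes a: "a dvd n" and f: "\<And>i k. f i = f k \<longleftrightarrow> int n dvd i - k"
  shows "finite (f ` {i. int a dvd i - j}) \<and> card (f ` {i. int a dvd i - j}) = n div a"
proof -
  obtain m where m: "n = a * m" using a by auto
  have pos: "a > 0" "m > 0" using n_pos m by auto
  have "f ` {i. int a dvd i - j} = (\<lambda>k. f (j + int a * int k)) ` {..<m}"
  proof safe
    fix i assume "int a dvd i - j"
    then obtain q where q: "i - j = int a * q" by auto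
    have "i - (j + int a * (q mod int m)) = int a * (q - q mod int m)"
      using q by (simp add: algebra_simps)
    then have "int n dvd i - (j + int a * (q mod int m))"
      by (simp add: m flip: minus_mod_eq_mult_div)
    then have "f i = f (j + int a * int (nat (q mod int m)))"
      using f pos by simp
    moreover have "nat (q mod int m) < m" using pos by (simp add: nat_less_iff)
    ultimately show "f i \<in> (\<lambda>k. f (j + int a * int k)) ` {..<m}" by blast
  next
    fix k assume "k < m"
    show "f (j + int a * int k) \<in> f ` {i. int a dvd i - j}" by (rule imageI) simp
  qed
  moreover have "inj_on (\<lambda>k. f (j + int a * int k)) {..<m}"
  proof (rule inj_onI)
    fix x y assume xy: "x \<in> {..<m}" "y \<in> {..<m}" "f (j + int a * int x) = f (j + int a * int y)"
    then have "int a * int m dvd int a * (int x - int y)" by (simp add: f m algebra_simps)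
    then have "int m dvd int x - int y" using pos by simp
    then show "x = y" using xy zdvd_imp_le[of "int m" "\<bar>int x - int y\<bar>"] by fastforce
  qed
  ultimately show ?thesis using m pos by (simp add: card_image)
qed

lemma card_rots: "a dvd n \<Longrightarrow> finite (rots a) \<and> card (rots a) = n div a"
  using card_multiples[of a rot 0] rot_eq_iff by (simp add: rots_def)

lemma card_dih: assumes "a dvd n" shows "finite (dih a j) \<and> card (dih a j) = 2 * (n div a)"
proof -
  have "rots a \<inter> refl ` {i. int a dvd i - j} = {}" using refl_notin_rots by auto
  then show ?thesis
    using card_rots[OF assms] card_multiples[OF assms, of refl j] refl_eq_iff
    by (simp add: dih_def card_Un_disjoint)
qed

section \<open>Exact factorizations as conditions on exponents\<close>

lemma bex_dihedral:
  assumes "H \<subseteq> carrier G"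
  shows "(\<exists>h\<in>H. P h) \<longleftrightarrow> (\<exists>x. rot x \<in> H \<and> P (rot x)) \<or> (\<exists>x. refl x \<in> H \<and> P (refl x))"
proof
  assume "\<exists>h\<in>H. P h"
  then obtain h where h: "h \<in> H" "P h" by auto
  then have "h \<in> carrier G" using assms by auto
  then show "(\<exists>x. rot x \<in> H \<and> P (rot x)) \<or> (\<exists>x. refl x \<in> H \<and> P (refl x))"
    using h by (cases h rule: carrier_cases) auto
qed auto

lemma rot_in_set_mult:
  assumes "H \<subseteq> carrier G" "K \<subseteq> carrier G"
  shows "rot i \<in> H <#> K \<longleftrightarrow>
    (\<exists>x. rot x \<in> H \<and> rot (i - x) \<in> K) \<or> (\<exists>x. refl x \<in> H \<and> refl (x - i) \<in> K)"
  by (simp add: set_mult_mem_iff assms bex_dihedral inv_rot inv_refl mult_table)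

lemma refl_in_set_mult:
  assumes "H \<subseteq> carrier G" "K \<subseteq> carrier G"
  shows "refl i \<in> H <#> K \<longleftrightarrow>
    (\<exists>x. rot x \<in> H \<and> refl (i - x) \<in> K) \<or> (\<exists>x. refl x \<in> H \<and> rot (x - i) \<in> K)"
  by (simp add: set_mult_mem_iff assms bex_dihedral inv_rot inv_refl mult_table)

lemma exact_factorization_iff:
  assumes H: "subgroup H G" and K: "subgroup K G"
  shows "exact_factorization G H K \<longleftrightarrow>
    (\<forall>i. rot i \<in> H <#> K) \<and> (\<forall>i. refl i \<in> H <#> K) \<and>
    (\<forall>i. rot i \<in> H \<and> rot i \<in> K \<longrightarrow> int n dvd i) \<and> (\<forall>i. \<not> (refl i \<in> H \<and> refl i \<in> K))"
proof -
  have sub: "H \<subseteq> carrier G" "K \<subseteq> carrier G" using H K subgroup.subset by auto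
  have "H <#> K \<subseteq> carrier G" using sub by (rule set_mult_closed)
  then have prod: "H <#> K = carrier G \<longleftrightarrow> (\<forall>i. rot i \<in> H <#> K) \<and> (\<forall>i. refl i \<in> H <#> K)"
    unfolding carrier_eq by auto
  have one: "\<one> \<in> H" "\<one> \<in> K" using H K subgroup.one_closed by auto
  have triv: "H \<inter> K = {\<one>} \<longleftrightarrow> (\<forall>g\<in>H \<inter> K. g = \<one>)" using one by auto
  have "(\<forall>g\<in>H \<inter> K. g = \<one>) \<longleftrightarrow> \<not> (\<exists>g\<in>H \<inter> K. g \<noteq> \<one>)" by blast
  also have "\<dots> \<longleftrightarrow> (\<forall>i. rot i \<in> H \<and> rot i \<in> K \<longrightarrow> int n dvd i) \<and> (\<forall>i. \<not> (refl i \<in> H \<and> refl i \<in> K))"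
    using sub by (subst bex_dihedral) (auto simp: one_eq rot_eq_iff refl_neq_rot)
  finally show ?thesis using H K prod triv by (simp add: exact_factorization_def)
qed

text \<open>The product is the whole group iff \<open>gcd a b = 1\<close>, and the intersection is
  trivial iff \<open>lcm a b = n\<close>. The product of gcd and lcm is
  \<open>a * b\<close>.\<close>

lemma exact_rots_dih_iff:
  assumes a: "a dvd n" and b: "b dvd n"
  shows "exact_factorization G (rots a) (dih b j) \<longleftrightarrow> coprime a b \<and> a * b = n"
proof -
  have 1: "(\<exists>x. int a dvd x \<and> int b dvd i - x) \<longleftrightarrow> int (gcd a b) dvd i" for i
    using ex_int_simultaneous_congruence[of a 0 b i] by (simp add: dvd_diff_commute[of "int b" i])
  have 2: "(\<exists>x. int a dvd x \<and> int b dvd i - x - j) \<longleftrightarrow> int (gcd a b) dvd i - j" for i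
    using 1[of "i - j"] by (simp add: algebra_simps)
  have "exact_factorization G (rots a) (dih b j) \<longleftrightarrow>
      (\<forall>i. int (gcd a b) dvd i) \<and> (\<forall>i. int (gcd a b) dvd i - j) \<and> lcm a b = n"
    by (simp add: exact_factorization_iff subgroup_rots subgroup_dih a b rot_in_set_mult
        refl_in_set_mult mem_simps 1 2 common_multiples_iff_lcm)
  also have "\<dots> \<longleftrightarrow> gcd a b = 1 \<and> lcm a b = n"
  proof -
    have "gcd a b = 1" if "\<forall>i. int (gcd a b) dvd i"
      using that[THEN spec, of 1] by simp
    then show ?thesis by auto
  qed
  also have "\<dots> \<longleftrightarrow> coprime a b \<and> a * b = n"
    using prod_gcd_lcm_nat[of a b] by (metis coprime_iff_gcd_eq_1 mult_1)
  finally show ?thesis .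
qed

text \<open>Let \<open>g = gcd a b\<close>. The rotations in the product have exponents in the
  residue classes of 0 and \<open>i - j\<close> modulo \<open>g\<close>, while the absence of a
  common reflection says that these classes differ. Two distinct classes cover the integers only for
  \<open>g = 2\<close>.\<close>

lemma exact_dih_dih_iff:
  assumes a: "a dvd n" and b: "b dvd n"
  shows "exact_factorization G (dih a i) (dih b j) \<longleftrightarrow>
    gcd a b = 2 \<and> lcm a b = n \<and> odd (i - j)"
proof -
  let ?g = "int (gcd a b)"
  note crt = ex_int_simultaneous_congruence[of a _ b]
  have 1: "(\<exists>x. int a dvd x \<and> int b dvd k - x) \<longleftrightarrow> ?g dvd k" for k
    using crt[of 0 k] by (simp add: dvd_diff_commute[of "int b" k])
  have 2: "(\<exists>x. int a dvd x - i \<and> int b dvd x - k - j) \<longleftrightarrow> ?g dvd k - (i - j)" for k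
    using crt[of i "k + j"] dvd_diff_commute[of ?g k "i - j"] by (simp add: algebra_simps)
  have 3: "(\<exists>x. int a dvd x \<and> int b dvd k - x - j) \<longleftrightarrow> ?g dvd k - j" for k
    using 1[of "k - j"] by (simp add: algebra_simps)
  have 4: "(\<exists>x. int a dvd x - i \<and> int b dvd x - k) \<longleftrightarrow> ?g dvd k - i" for k
    using crt[of i k] dvd_diff_commute[of ?g k i] by simp
  have 5: "(\<forall>x. int a dvd x - i \<longrightarrow> \<not> int b dvd x - j) \<longleftrightarrow> \<not> ?g dvd i - j"
    using crt[of i j] by auto
  have "exact_factorization G (dih a i) (dih b j) \<longleftrightarrow>
      (\<forall>k. ?g dvd k \<or> ?g dvd k - (i - j)) \<and> (\<forall>k. ?g dvd k - j \<or> ?g dvd k - i)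
      \<and> lcm a b = n \<and> \<not> ?g dvd i - j"
    by (simp add: exact_factorization_iff subgroup_dih a b rot_in_set_mult
        refl_in_set_mult mem_simps 1 2 3 4 5 common_multiples_iff_lcm)
  also have "\<dots> \<longleftrightarrow> gcd a b = 2 \<and> lcm a b = n \<and> odd (i - j)"
  proof -
    have "gcd a b = 2" if cover: "\<forall>k. ?g dvd k \<or> ?g dvd k - (i - j)" and ndvd: "\<not> ?g dvd i - j"
    proof -
      \<comment> \<open>Neither 1 nor -1 is divisible by \<open>g\<close>, so both lie in the class
        of \<open>i - j\<close>, and \<open>g\<close> divides their difference 2.\<close>
      have "\<not> ?g dvd 1" using ndvd by (meson dvd_trans one_dvd)
      then have "?g dvd 1 - (i - j)" "?g dvd - 1 - (i - j)"
        using cover[THEN spec, of 1] cover[THEN spec, of "- 1"] by auto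
      from dvd_diff[OF this] have "?g dvd int 2" by simp
      then have "gcd a b dvd 2" by (simp only: int_dvd_int_iff)
      then show ?thesis using \<open>\<not> ?g dvd 1\<close> by (metis dvd_refl of_nat_1 prime_nat_iff two_is_prime_nat)
    qed
    moreover have "even k \<or> even (k - (i - j))" "even (k - j) \<or> even (k - i)" if "odd (i - j)" for k
      using that by auto
    moreover have "int 2 dvd k \<longleftrightarrow> even k" for k by simp
    ultimately show ?thesis by metis
  qed
  finally show ?thesis .
qed

lemma not_exact_rots_rots: "a dvd n \<Longrightarrow> b dvd n \<Longrightarrow> \<not> exact_factorization G (rots a) (rots b)"
  by (simp add: exact_factorization_iff subgroup_rots refl_in_set_mult refl_notin_rots)

section \<open>Isomorphism types of the subgroups\<close>

lemma dih_iso_dih: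
  assumes a: "a dvd n"
  shows "G\<lparr>carrier := dih a i\<rparr> \<cong> G\<lparr>carrier := dih a j\<rparr>"
proof -
  \<comment> \<open>\<open>f t\<close> fixes the rotations and shifts every reflection exponent by
    \<open>t\<close>. It respects multiplication on the whole group, and \<open>f (- t)\<close>
    undoes it.\<close>
  define f where "f t g = (if g \<in> range rot then g else rot t \<otimes> g)" for t g
  have f_rot: "f t (rot x) = rot x" and f_refl: "f t (refl x) = refl (t + x)" for t x
    by (auto simp: f_def rot_refl refl_neq_rot)
  have f_mem: "f (k - l) g \<in> dih a k" and f_f: "f (l - k) (f (k - l) g) = g"
    if "g \<in> dih a l" for g k l
  proof -
    have "g \<in> carrier G" using that subset_carrier by blast
    then have "f (k - l) g \<in> dih a k \<and> f (l - k) (f (k - l) g) = g"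
      using that by (cases g rule: carrier_cases) (auto simp: f_rot f_refl mem_simps a)
    then show "f (k - l) g \<in> dih a k" "f (l - k) (f (k - l) g) = g" by auto
  qed
  have hom: "f t (g \<otimes> h) = f t g \<otimes> f t h" if "g \<in> carrier G" "h \<in> carrier G" for g h t
    using that
    by (auto elim!: carrier_cases simp: f_rot f_refl mult_table algebra_simps)
  have "f (j - i) \<in> iso (G\<lparr>carrier := dih a i\<rparr>) (G\<lparr>carrier := dih a j\<rparr>)"
  proof (rule isoI)
    show "f (j - i) \<in> hom (G\<lparr>carrier := dih a i\<rparr>) (G\<lparr>carrier := dih a j\<rparr>)"
      using f_mem hom subsetD[OF subset_carrier(2)] by (auto simp: hom_def)
    show "bij_betw (f (j - i)) (carrier (G\<lparr>carrier := dih a i\<rparr>)) (carrier (G\<lparr>carrier := dih a j\<rparr>))"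
      using f_mem f_f by (intro bij_betw_byWitness[of _ "f (i - j)"]) auto
  qed
  then show ?thesis by (rule is_isoI)
qed

text \<open>A noncyclic \<^term>\<open>dih b j\<close> contains two distinct reflections, but a cyclic group has at most one involution.\<close>

lemma dih_iso_rotsD:
  assumes a: "a dvd n" and b: "b dvd n"
    and iso: "G\<lparr>carrier := dih b j\<rparr> \<cong> G\<lparr>carrier := rots a\<rparr>"
  shows "b = n"
proof -
  obtain f where "f \<in> iso (G\<lparr>carrier := dih b j\<rparr>) (G\<lparr>carrier := rots a\<rparr>)"
    using iso by (auto simp: is_iso_def)
  then have hom: "\<And>g h. g \<in> dih b j \<Longrightarrow> h \<in> dih b j \<Longrightarrow> f (g \<otimes> h) = f g \<otimes> f h"
    and inj: "inj_on f (dih b j)" and mem: "\<And>g. g \<in> dih b j \<Longrightarrow> f g \<in> rots a"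
    by (auto simp: iso_def hom_def bij_betw_def)
  have one: "\<one> \<in> dih b j" using subgroup_dih[OF b] by (rule subgroup.one_closed)
  have "f \<one> \<in> carrier G" using mem[OF one] subset_carrier by blast
  then have f_one: "f \<one> = \<one>" using hom[OF one one] l_cancel_one[of "f \<one>" "f \<one>"] by simp
  have involution: "\<exists>x. f (refl k) = rot x \<and> int n dvd 2 * x \<and> \<not> int n dvd x"
    if k: "refl k \<in> dih b j" for k
  proof -
    obtain x where x: "f (refl k) = rot x" using mem[OF k] by (auto simp: rots_def)
    have "rot (2 * x) = rot 0" using hom[OF k k] x f_one by (simp add: mult_table one_eq)
    moreover have "rot x \<noteq> rot 0"
      using inj_onD[OF inj _ k one] x f_one by (auto simp: one_eq refl_neq_rot)
    ultimately show ?thesis using x by (intro exI[of _ x]) (simp add: rot_eq_iff)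
  qed
  have k: "refl j \<in> dih b j" "refl (j + int b) \<in> dih b j" by (simp_all add: mem_simps b)
  obtain x where x: "f (refl j) = rot x" "int n dvd 2 * x" "\<not> int n dvd x"
    using involution[OF k(1)] by auto
  obtain y where y: "f (refl (j + int b)) = rot y" "int n dvd 2 * y" "\<not> int n dvd y"
    using involution[OF k(2)] by auto
  obtain p where p: "2 * x = int n * p" using x by auto
  obtain q where q: "2 * y = int n * q" using y by auto
  \<comment> \<open>Since \<open>n\<close> divides \<open>2 * x\<close> but not \<open>x\<close>,
    the quotient \<open>p\<close> is odd, and so is \<open>q\<close>. Hence \<open>x\<close> and
    \<open>y\<close> are odd multiples of \<open>n / 2\<close> and agree modulo
    \<open>n\<close>.\<close>
  have "odd p"
  proof
    assume "even p"
    then obtain r where "p = 2 * r" by auto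
    then have "x = int n * r" using p by simp
    then show False using x by simp
  qed
  moreover have "odd q"
  proof
    assume "even q"
    then obtain r where "q = 2 * r" by auto
    then have "y = int n * r" using q by simp
    then show False using y by simp
  qed
  ultimately have "even (p - q)" by simp
  then obtain r where "p - q = 2 * r" by (rule evenE)
  then have "2 * x - 2 * y = 2 * (int n * r)"
    using p q by (simp add: mult.left_commute flip: right_diff_distrib)
  then have "x - y = int n * r" by simp
  then have "rot x = rot y" by (simp add: rot_eq_iff)
  then have "refl j = refl (j + int b)" using x y inj_onD[OF inj _ k] by simp
  then have "n dvd b" by (simp add: refl_eq_iff)
  then show ?thesis using b by (simp add: dvd_antisym)
qed

text \<open>A complete isomorphism invariant of subgroups: the order, and whether the group is cyclic.\<close>

definition kind :: "'a set \<Rightarrow> nat \<times> bool" where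
  "kind H = (card H, H \<subseteq> range rot \<or> card H = 2)"

lemma kind_rots: "a dvd n \<Longrightarrow> kind (rots a) = (n div a, True)"
  by (auto simp: kind_def card_rots) (auto simp: rots_def)

lemma kind_dih: assumes a: "a dvd n" shows "kind (dih a j) = (2 * (n div a), n div a = 1)"
proof -
  have "refl j \<in> dih a j" by (simp add: mem_simps a)
  then have "\<not> dih a j \<subseteq> range rot" using refl_neq_rot by blast
  then show ?thesis by (simp add: kind_def card_dih a)
qed

lemma div_n_eq_iff: "a dvd n \<Longrightarrow> b dvd n \<Longrightarrow> n div a = n div b \<longleftrightarrow> a = b"
  using n_pos by (metis dvd_div_mult_self mult_cancel_left mult_is_0 not_gr0)

text \<open>Isomorphic subgroups have equal order, and an isomorphism between a \<open>rots\<close>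
  and a \<open>dih\<close> forces order two, where the kinds agree. Conversely, apart from order
  two, the kind determines the shape and the divisor, and the offset of a \<open>dih\<close> does
  not affect its isomorphism type.\<close>

lemma iso_iff_kind_eq:
  assumes H: "subgroup H G" and L: "subgroup L G"
  shows "G\<lparr>carrier := H\<rparr> \<cong> G\<lparr>carrier := L\<rparr> \<longleftrightarrow> kind H = kind L"
proof
  assume iso: "G\<lparr>carrier := H\<rparr> \<cong> G\<lparr>carrier := L\<rparr>"
  have "group (G\<lparr>carrier := H\<rparr>)" using H by (rule subgroup_imp_group)
  then have iso': "G\<lparr>carrier := L\<rparr> \<cong> G\<lparr>carrier := H\<rparr>" using iso by (rule group.iso_sym)
  have card: "card H = card L" using iso_same_card[OF iso] by simp
  show "kind H = kind L"
    using H
  proof (cases H rule: subgroup_cases)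
    case (1 a)
    from L show ?thesis
    proof (cases L rule: subgroup_cases)
      case (2 b j)
      have "b = n" using dih_iso_rotsD[OF 1(1) 2(1)] iso' 1 2 by simp
      then show ?thesis using 1 2 card n_pos by (simp add: kind_rots kind_dih card_rots card_dih)
    qed (use 1 card in \<open>simp add: kind_rots card_rots\<close>)
  next
    case (2 b j)
    from L show ?thesis
    proof (cases L rule: subgroup_cases)
      case (1 a)
      have "b = n" using dih_iso_rotsD[OF 1(1) 2(1)] iso 1 2 by simp
      then show ?thesis using 1 2 card n_pos by (simp add: kind_rots kind_dih card_rots card_dih)
    qed (use 2 card in \<open>simp add: kind_dih card_dih\<close>)
  qed
next
  assume kind: "kind H = kind L"
  then have card: "card H = card L" by (simp add: kind_def)
  show "G\<lparr>carrier := H\<rparr> \<cong> G\<lparr>carrier := L\<rparr>"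
  proof (cases "card H = 2")
    case True
    then show ?thesis using H L card by (intro iso_subgroups_card_2) auto
  next
    case False
    from H show ?thesis
    proof (cases H rule: subgroup_cases)
      case (1 a)
      from L show ?thesis
      proof (cases L rule: subgroup_cases)
        case (1 b)
        then have "a = b" using kind \<open>a dvd n\<close> \<open>H = rots a\<close> by (simp add: kind_rots div_n_eq_iff)
        then show ?thesis using 1 \<open>H = rots a\<close> by simp
      next
        case (2 b j)
        then show ?thesis using kind False card 1 by (simp add: kind_rots kind_dih card_dih)
      qed
    next
      case (2 a i)
      from L show ?thesis
      proof (cases L rule: subgroup_cases)
        case (1 b)
        then show ?thesis using kind False card 2 by (simp add: kind_rots kind_dih card_dih)
      next
        case (2 b j)
        then have "a = b" using kind \<open>a dvd n\<close> \<open>H = dih a i\<close> by (simp add: kind_dih div_n_eq_iff)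
        then show ?thesis using 2 \<open>H = dih a i\<close> dih_iso_dih by simp
      qed
    qed
  qed
qed

end

section \<open>Counting the classes\<close>

text \<open>\<^term>\<open>(b, True)\<close> stands for a cyclic group of order \<open>b\<close>, and \<^term>\<open>(2 * d, d = 1)\<close> for a dihedral
  group of order \<open>2 * d\<close>, which is cyclic exactly when \<^term>\<open>d = 1\<close>.\<close>

definition cyclic_dihedral_types :: "nat \<Rightarrow> (nat \<times> bool) set set" where
  "cyclic_dihedral_types n =
    (\<lambda>b. {(b, True), (2 * (n div b), n div b = 1)}) ` (unitary_divisors n - {1})"

definition dihedral_dihedral_types :: "nat \<Rightarrow> (nat \<times> bool) set set" where
  "dihedral_dihedral_types m =
    (\<lambda>u. {(2 * u, u = 1), (2 * (m div u), m div u = 1)}) ` unitary_divisors m"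

lemma one_unitary_divisor: "1 \<in> unitary_divisors m"
  by (simp add: unitary_divisors_def)

lemma finite_types:
  assumes "m > 0"
  shows "finite (cyclic_dihedral_types m)" "finite (dihedral_dihedral_types m)"
  using finite_unitary_divisors[OF assms]
  by (auto simp: cyclic_dihedral_types_def dihedral_dihedral_types_def)

lemma card_cyclic_dihedral_types:
  assumes "n > 0"
  shows "card (cyclic_dihedral_types n) = 2 ^ prime_omega n - 1"
proof -
  have "inj_on (\<lambda>b. {(b, True), (2 * (n div b), n div b = 1)}) (unitary_divisors n - {1})"
    \<comment> \<open>If the members of two equal pairs match crosswise, both flags are
      \<open>True\<close>, so both quotients are 1 and both divisors equal 2.\<close>
    by (rule inj_onI) (unfold doubleton_eq_iff prod.inject, metis)
  then have "card (cyclic_dihedral_types n) = card (unitary_divisors n - {1})"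
    unfolding cyclic_dihedral_types_def by (rule card_image)
  also have "\<dots> = 2 ^ prime_omega n - 1"
    by (subst card_Diff_singleton[OF one_unitary_divisor])
      (simp add: card_unitary_divisors assms)
  finally show ?thesis .
qed

text \<open>The relabelling of \<open>u\<close> by \<open>(2 * u, u = 1)\<close> is injective, so it
  preserves the number of unordered pairs.\<close>

lemma card_dihedral_dihedral_types:
  "card (dihedral_dihedral_types m) = card ((\<lambda>d. {d, m div d}) ` unitary_divisors m)"
proof -
  let ?g = "\<lambda>u::nat. (2 * u, u = 1)"
  have "inj ?g" by (rule injI) auto
  then have "inj_on (image ?g) A" for A by (simp add: inj_on_def inj_image_eq_iff)
  moreover have "dihedral_dihedral_types m = image ?g ` (\<lambda>d. {d, m div d}) ` unitary_divisors m"
    by (simp add: dihedral_dihedral_types_def image_image)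
  ultimately show ?thesis by (simp add: card_image)
qed

text \<open>In a pair of dihedral types the flag \<open>True\<close> occurs only at order two. A
  common type therefore has \<open>b = 2\<close>, and 2 is a unitary divisor of \<open>2 * m\<close>
  only for odd \<open>m\<close>.\<close>

lemma inter_types:
  assumes m: "m > 0"
  shows "cyclic_dihedral_types (2 * m) \<inter> dihedral_dihedral_types m =
    (if odd m then {{(2, True), (2 * m, m = 1)}} else {})"
proof (rule Set.set_eqI)
  fix t
  have "t \<in> cyclic_dihedral_types (2 * m) \<inter> dihedral_dihedral_types m \<longleftrightarrow>
      odd m \<and> t = {(2, True), (2 * m, m = 1)}"
  proof
    assume "t \<in> cyclic_dihedral_types (2 * m) \<inter> dihedral_dihedral_types m"
    then obtain b u where b: "b \<in> unitary_divisors (2 * m)" "b \<noteq> 1"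
        "t = {(b, True), (2 * (2 * m div b), 2 * m div b = 1)}"
      and u: "u \<in> unitary_divisors m" "t = {(2 * u, u = 1), (2 * (m div u), m div u = 1)}"
      unfolding cyclic_dihedral_types_def dihedral_dihedral_types_def by blast
    have "(b, True) \<in> {(2 * u, u = 1), (2 * (m div u), m div u = 1)}"
      unfolding u(2)[symmetric] b(3) by (rule insertI1)
    then have "b = 2" by auto
    then show "odd m \<and> t = {(2, True), (2 * m, m = 1)}"
      using b by (auto simp: unitary_divisors_def)
  next
    assume t: "odd m \<and> t = {(2, True), (2 * m, m = 1)}"
    then have "2 \<in> unitary_divisors (2 * m) - {1}" by (auto simp: unitary_divisors_def)
    then have "t \<in> cyclic_dihedral_types (2 * m)"
      unfolding cyclic_dihedral_types_def by (rule rev_image_eqI) (use t in simp)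
    moreover have "t \<in> dihedral_dihedral_types m"
      unfolding dihedral_dihedral_types_def using one_unitary_divisor
      by (rule rev_image_eqI) (use t in simp)
    ultimately show "t \<in> cyclic_dihedral_types (2 * m) \<inter> dihedral_dihedral_types m" by simp
  qed
  then show "t \<in> cyclic_dihedral_types (2 * m) \<inter> dihedral_dihedral_types m \<longleftrightarrow>
      t \<in> (if odd m then {{(2, True), (2 * m, m = 1)}} else {})" by simp
qed

section \<open>The types realized by nontrivial exact factorizations\<close>

context dihedral
begin

text \<open>The unordered pair of kinds is a complete invariant: the swap allowed by the equivalence
  is exactly the loss of order.\<close>

lemma f2_eq_card_types:
  "f2 G = card ((\<lambda>(H, K). {kind H, kind K}) ` nontrivial_exact_factorizations G)"
proof -
  let ?F = "nontrivial_exact_factorizations G" and ?t = "\<lambda>(H, K). {kind H, kind K}"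
  have eqv: "factorization_equiv G p q \<longleftrightarrow> ?t p = ?t q" if "p \<in> ?F" "q \<in> ?F" for p q
  proof -
    obtain H K L M where [simp]: "p = (H, K)" "q = (L, M)" by (cases p, cases q)
    have "subgroup H G" "subgroup K G" "subgroup L G" "subgroup M G"
      using that by (auto simp: nontrivial_exact_factorizations_def exact_factorization_def)
    then show ?thesis
      by (simp add: factorization_equiv_def iso_iff_kind_eq doubleton_eq_iff)
  qed
  have "{(p, q). p \<in> ?F \<and> q \<in> ?F \<and> factorization_equiv G p q} =
      {(p, q). p \<in> ?F \<and> q \<in> ?F \<and> ?t p = ?t q}"
    by (intro Collect_cong) (simp only: case_prod_beta eqv cong: conj_cong)
  then show ?thesis by (simp only: f2_def card_quotient_eq_card_image)
qed

lemma rots_trivial_iff: "a dvd n \<Longrightarrow> rots a = {\<one>} \<longleftrightarrow> a = n"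
proof
  assume a: "a dvd n" and "rots a = {\<one>}"
  then have "n div a = n div n" using card_rots[OF a] n_pos by simp
  then show "a = n" using div_n_eq_iff[OF a] by simp
next
  assume "a dvd n" "a = n"
  then show "rots a = {\<one>}"
    by (intro set_eqI_dihedral) (auto simp: mem_simps one_eq rot_eq_iff refl_neq_rot)
qed

lemma dih_nontrivial: "a dvd n \<Longrightarrow> dih a j \<noteq> {\<one>}"
  using refl_in_dih[of a j j] refl_neq_rot[of j 0] unfolding one_eq by (metis diff_self dvd_0_right singletonD)

text \<open>As \<open>a * b = n\<close>, the cyclic factor has order \<open>b\<close> and the other
  one order \<open>2 * a\<close>. Nontriviality of the cyclic factor is
  \<open>b \<noteq> 1\<close>.\<close>

lemma exact_rots_dih_type:
  assumes a: "a dvd n" and b: "b dvd n"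
    and ex: "exact_factorization G (rots a) (dih b j)" and nt: "rots a \<noteq> {\<one>}"
  shows "{kind (rots a), kind (dih b j)} \<in> cyclic_dihedral_types n"
proof -
  have ab: "coprime a b" "a * b = n" using ex by (auto simp: exact_rots_dih_iff a b)
  then have pos: "a > 0" "b > 0" using n_pos by auto
  then have div: "n div a = b" "n div b = a" using ab by auto
  have "b \<in> unitary_divisors n"
    using b div ab by (simp add: unitary_divisors_def coprime_commute)
  moreover have "b \<noteq> 1" using nt ab by (auto simp: rots_trivial_iff a)
  ultimately show ?thesis
    using div by (auto simp: cyclic_dihedral_types_def kind_rots kind_dih a b)
qed

lemma exact_dih_dih_type:
  assumes a: "a dvd n" and b: "b dvd n"
    and ex: "exact_factorization G (dih a i) (dih b j)"
  shows "even n \<and> {kind (dih a i), kind (dih b j)} \<in> dihedral_dihedral_types (n div 2)"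
proof -
  have g: "gcd a b = 2" "lcm a b = n" using ex by (auto simp: exact_dih_dih_iff a b)
  \<comment> \<open>Halving turns \<open>gcd a b = 2\<close> into coprimality of \<open>u\<close>
    and \<open>v\<close>, with \<open>u * v = n div 2\<close>. The orders come out crosswise:
    \<open>dih a i\<close> has order \<open>2 * v\<close> and \<open>dih b j\<close> has order
    \<open>2 * u\<close>.\<close>
  obtain u v where uv: "a = 2 * u" "b = 2 * v" using g by (metis dvdE gcd_dvd1 gcd_dvd2)
  have "coprime u v" using g uv by (simp add: coprime_iff_gcd_eq_1 flip: gcd_mult_distrib_nat)
  have "a * b = 2 * n" using prod_gcd_lcm_nat[of a b] g by simp
  then have n: "n = 2 * (u * v)" using uv by simp
  then have pos: "u > 0" "v > 0" using n_pos by auto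
  have div: "n div a = v" "n div b = u" "n div 2 = u * v" using n uv pos by auto
  have "v \<in> unitary_divisors (u * v)"
    using \<open>coprime u v\<close> pos by (simp add: unitary_divisors_def coprime_commute)
  then have "{kind (dih a i), kind (dih b j)} \<in> dihedral_dihedral_types (u * v)"
    unfolding dihedral_dihedral_types_def
    by (rule rev_image_eqI) (use div pos in \<open>simp add: kind_dih a b\<close>)
  then show ?thesis using n div by simp
qed

lemma factorization_types:
  "(\<lambda>(H, K). {kind H, kind K}) ` nontrivial_exact_factorizations G =
    cyclic_dihedral_types n \<union> (if even n then dihedral_dihedral_types (n div 2) else {})"
    (is "?T = ?C \<union> ?D")
proof (intro equalityI subsetI)
  fix t assume "t \<in> ?T"
  then obtain H K where t: "t = {kind H, kind K}" and ex: "exact_factorization G H K"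
    and nt: "H \<noteq> {\<one>}" "K \<noteq> {\<one>}"
    by (auto simp: nontrivial_exact_factorizations_def)
  then have H: "subgroup H G" and K: "subgroup K G" by (auto simp: exact_factorization_def)
  from H show "t \<in> ?C \<union> ?D"
  proof (cases H rule: subgroup_cases)
    case H: (1 a)
    from K show ?thesis
    proof (cases K rule: subgroup_cases)
      case (1 b)
      then show ?thesis using H ex not_exact_rots_rots by simp
    next
      case (2 b j)
      then show ?thesis using H ex nt t exact_rots_dih_type by simp
    qed
  next
    case H: (2 a i)
    from K show ?thesis
    proof (cases K rule: subgroup_cases)
      case (1 b)
      have "exact_factorization G K H" using ex by (rule exact_factorization_commute)
      then have "{kind K, kind H} \<in> ?C" using 1 H nt exact_rots_dih_type by simp
      then show ?thesis using t by (simp add: insert_commute)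
    next
      case (2 b j)
      then show ?thesis using H ex t exact_dih_dih_type[of a b i j] by simp
    qed
  qed
next
  fix t assume "t \<in> ?C \<union> ?D"
  then show "t \<in> ?T"
  proof
    assume "t \<in> ?C"
    then obtain b where b: "b \<in> unitary_divisors n" "b \<noteq> 1"
      and t: "t = {(b, True), (2 * (n div b), n div b = 1)}"
      by (auto simp: cyclic_dihedral_types_def)
    \<comment> \<open>A cyclic subgroup of order \<open>b\<close> is generated by the rotation with
      exponent \<open>n div b\<close>. The offset of the dihedral factor is arbitrary, and 0 is
      taken.\<close>
    define a where "a = n div b"
    have ab: "coprime a b" "a * b = n" "b dvd n"
      using b by (auto simp: unitary_divisors_def a_def coprime_commute)
    then have a: "a dvd n" "n div a = b" "a \<noteq> n" using b n_pos by auto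
    have "(rots a, dih b 0) \<in> nontrivial_exact_factorizations G"
      using ab a by (simp add: nontrivial_exact_factorizations_def exact_rots_dih_iff
          rots_trivial_iff dih_nontrivial)
    moreover have "t = {kind (rots a), kind (dih b 0)}"
      using ab a by (simp add: t kind_rots kind_dih flip: a_def)
    ultimately show ?thesis by (intro rev_image_eqI) auto
  next
    assume D: "t \<in> ?D"
    then have "even n" by (auto split: if_splits)
    then obtain m where m: "n = 2 * m" by auto
    then obtain u where u: "u \<in> unitary_divisors m"
      and t: "t = {(2 * u, u = 1), (2 * (m div u), m div u = 1)}"
      using D by (auto simp: dihedral_dihedral_types_def)
    \<comment> \<open>The factors will be \<open>dih (2 * v) 1\<close> and
      \<open>dih (2 * u) 0\<close>, of orders \<open>2 * u\<close> and \<open>2 * v\<close>; the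
      offsets 1 and 0 have the required odd difference.\<close>
    define v where "v = m div u"
    have uv: "coprime u v" "u * v = m" using u by (auto simp: unitary_divisors_def v_def)
    then have pos: "u > 0" "v > 0" using m n_pos by auto
    have dvd: "2 * v dvd n" "2 * u dvd n" using uv m by auto
    have div: "n div (2 * v) = u" "n div (2 * u) = v" using uv m pos by auto
    have gcd: "gcd (2 * v) (2 * u) = 2"
      using uv(1) by (simp add: gcd.commute flip: gcd_mult_distrib_nat)
    have "2 * lcm (2 * v) (2 * u) = 2 * v * (2 * u)"
      using prod_gcd_lcm_nat[of "2 * v" "2 * u"] gcd by simp
    then have "lcm (2 * v) (2 * u) = n" using uv m by simp
    then have "(dih (2 * v) 1, dih (2 * u) 0) \<in> nontrivial_exact_factorizations G"
      using dvd gcd by (simp add: nontrivial_exact_factorizations_def exact_dih_dih_iff dih_nontrivial)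
    moreover have "t = {kind (dih (2 * v) 1), kind (dih (2 * u) 0)}"
      using dvd div by (simp add: t kind_dih flip: v_def)
    ultimately show ?thesis by (intro rev_image_eqI) auto
  qed
qed

section \<open>The closed formulas\<close>

lemma f2_odd: "odd n \<Longrightarrow> f2 G = 2 ^ prime_omega n - 1"
  unfolding f2_eq_card_types factorization_types
  by (simp add: card_cyclic_dihedral_types n_pos)

text \<open>Inclusion-exclusion for the two families of types, with the overlap moved to the left to
  avoid truncated subtraction.\<close>

lemma f2_even:
  assumes n: "n = 2 * m"
  shows "f2 G + (if odd m then 1 else 0) =
    (2 ^ prime_omega n - 1) + card ((\<lambda>d. {d, m div d}) ` unitary_divisors m)"
proof -
  have m: "m > 0" using n n_pos by simp
  have "f2 G = card (cyclic_dihedral_types n \<union> dihedral_dihedral_types m)"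
    by (simp add: f2_eq_card_types factorization_types n)
  moreover have "card (cyclic_dihedral_types n \<inter> dihedral_dihedral_types m) = (if odd m then 1 else 0)"
    by (simp add: n inter_types m)
  ultimately show ?thesis
    using card_Un_Int[OF finite_types(1)[OF n_pos] finite_types(2)[OF m]]
    by (simp add: card_cyclic_dihedral_types card_dihedral_dihedral_types n_pos)
qed

text \<open>At \<open>n = 2\<close> the closed form for even \<open>n\<close> would give 1/2, since
  halving the number of unitary divisors of \<open>n div 2\<close> fails there.\<close>

lemma f2_formula:
  "(odd n \<longrightarrow> real (f2 G) = 2 ^ prime_omega n - 1) \<and>
    (even n \<and> n \<noteq> 2 \<longrightarrow>
      real (f2 G) =
        2 ^ prime_omega n + 2 powi (int (prime_omega (n div 2)) - 1)
        + real (prime_omega (n div 2)) - real (prime_omega n) - 1) \<and>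
    (n = 2 \<longrightarrow> f2 G = 1)"
proof (intro conjI impI)
  assume "odd n"
  then show "real (f2 G) = 2 ^ prime_omega n - 1" by (simp add: f2_odd of_nat_diff)
next
  assume even: "even n \<and> n \<noteq> 2"
  then obtain m where n: "n = 2 * m" by auto
  then have m: "m > 1" using even n_pos by auto
  let ?D = "card ((\<lambda>d. {d, m div d}) ` unitary_divisors m)"
  have "real (2 * ?D) = real (2 ^ prime_omega m)"
    by (simp only: card_unordered_unitary_divisors[OF m])
  then have powi: "2 powi (int (prime_omega m) - 1) = real ?D"
    by (simp add: power_int_diff)
  have "real (f2 G + (if odd m then 1 else 0)) = real ((2 ^ prime_omega n - 1) + ?D)"
    by (simp only: f2_even[OF n])
  then have "real (f2 G) + (if odd m then 1 else 0) = 2 ^ prime_omega n - 1 + real ?D"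
    unfolding of_nat_add by (simp add: of_nat_diff split: if_splits)
  \<comment> \<open>This turns the overlap, which is 1 exactly for odd \<open>m\<close>, into the
    difference of the two values of \<open>prime_omega\<close>.\<close>
  moreover have "prime_omega n = prime_omega m + (if odd m then 1 else 0)"
    using prime_omega_double[of m] m n by simp
  ultimately show "real (f2 G) = 2 ^ prime_omega n + 2 powi (int (prime_omega (n div 2)) - 1)
        + real (prime_omega (n div 2)) - real (prime_omega n) - 1"
    using n powi by (simp split: if_splits)
next
  assume n: "n = 2"
  have "{p::nat. prime p \<and> p dvd 1} = {}" using not_prime_unit by blast
  then have "prime_omega 1 = 0" unfolding prime_omega_def by simp
  then have "prime_omega 2 = 1" using prime_omega_double[of 1] by simp
  moreover have "unitary_divisors 1 = {1}" by (auto simp: unitary_divisors_def)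
  ultimately show "f2 G = 1" using f2_even[of 1] n by simp
qed

end

section \<open>The presented group\<close>

text \<open>Generation is expressed by \<open>gen\<close> as an induction principle for right
  multiplication by generators. The hypotheses \<open>order\<close> and \<open>nonrot\<close>
  exclude collapse.\<close>

lemma (in group) dihedralI:
  fixes n :: nat
  assumes n: "n > 0" and \<rho>: "\<rho> \<in> carrier G" and \<sigma>: "\<sigma> \<in> carrier G"
    and pow: "\<rho> [^] n = \<one>" and sq: "\<sigma> \<otimes> \<sigma> = \<one>" and conj: "\<rho> \<otimes> \<sigma> = \<sigma> \<otimes> inv \<rho>"
    and gen: "\<And>N. \<one> \<in> N \<Longrightarrow> (\<And>x. x \<in> N \<Longrightarrow> x \<otimes> \<rho> \<in> N \<and> x \<otimes> inv \<rho> \<in> N \<and> x \<otimes> \<sigma> \<in> N) \<Longrightarrow> carrier G \<subseteq> N"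
    and order: "\<And>i::int. \<rho> [^] i = \<one> \<Longrightarrow> int n dvd i"
    and nonrot: "\<And>i::int. \<rho> [^] i \<noteq> \<sigma>"
  shows "dihedral G n (\<lambda>i. \<rho> [^] i) (\<lambda>i. \<rho> [^] i \<otimes> \<sigma>)"
proof -
  have pow_add: "\<rho> [^] i \<otimes> \<rho> [^] j = \<rho> [^] (i + j)" for i j :: int
    using \<rho> by (simp add: int_pow_mult)
  \<comment> \<open>Moving \<open>\<sigma>\<close> past a power of \<open>\<rho>\<close> inverts the
    power; induction on \<open>j\<close> runs in both directions from 0.\<close>
  have swap: "\<sigma> \<otimes> \<rho> [^] j = \<rho> [^] (- j) \<otimes> \<sigma>" for j :: int
  proof -
    have "inv \<rho> = \<sigma> \<otimes> \<rho> \<otimes> \<sigma>"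
    proof -
      have "\<sigma> \<otimes> \<rho> \<otimes> \<sigma> = \<sigma> \<otimes> (\<sigma> \<otimes> inv \<rho>)" using \<rho> \<sigma> by (simp add: m_assoc conj)
      also have "\<dots> = inv \<rho>" using \<rho> \<sigma> sq by (simp flip: m_assoc)
      finally show ?thesis by simp
    qed
    then have c: "inv \<rho> \<otimes> \<sigma> = \<sigma> \<otimes> \<rho>" using \<rho> \<sigma> sq by (simp add: m_assoc)
    show ?thesis
    proof (induction j rule: int_induct[of _ 0])
      case base
      then show ?case using \<sigma> by simp
    next
      case (step1 j)
      have "\<sigma> \<otimes> \<rho> [^] (j + 1) = \<sigma> \<otimes> \<rho> [^] j \<otimes> \<rho>"
        using \<rho> \<sigma> by (simp add: int_pow_mult m_assoc)
      also have "\<dots> = \<rho> [^] (- j) \<otimes> (inv \<rho> \<otimes> \<sigma>)" using \<rho> \<sigma> step1 by (simp add: m_assoc c)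
      also have "\<dots> = \<rho> [^] (- j) \<otimes> \<rho> [^] (- 1 :: int) \<otimes> \<sigma>"
        using \<rho> \<sigma> by (simp add: m_assoc int_pow_neg)
      finally show ?case by (simp add: pow_add)
    next
      case (step2 j)
      have "\<sigma> \<otimes> \<rho> [^] (j - 1) = \<sigma> \<otimes> (\<rho> [^] j \<otimes> \<rho> [^] (- 1 :: int))" by (simp add: pow_add)
      also have "\<dots> = \<sigma> \<otimes> \<rho> [^] j \<otimes> inv \<rho>" using \<rho> \<sigma> by (simp add: int_pow_neg m_assoc)
      also have "\<dots> = \<rho> [^] (- j) \<otimes> (\<rho> \<otimes> \<sigma>)" using \<rho> \<sigma> step2 by (simp add: m_assoc conj)
      also have "\<dots> = \<rho> [^] (- j) \<otimes> \<rho> [^] (1 :: int) \<otimes> \<sigma>" using \<rho> \<sigma> by (simp add: m_assoc)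
      finally show ?case by (simp add: pow_add)
    qed
  qed
  have eq_iff: "\<rho> [^] i = \<rho> [^] j \<longleftrightarrow> int n dvd i - j" for i j :: int
  proof
    assume "\<rho> [^] i = \<rho> [^] j"
    then have "\<rho> [^] i \<otimes> \<rho> [^] (- j) = \<rho> [^] j \<otimes> \<rho> [^] (- j)" by simp
    then show "int n dvd i - j" using order[of "i - j"] by (simp add: pow_add)
  next
    assume "int n dvd i - j"
    then obtain q where q: "i - j = int n * q" by auto
    have "\<rho> [^] (int n * q) = (\<rho> [^] int n) [^] q" using \<rho> by (simp add: int_pow_pow)
    also have "\<dots> = \<one>" using pow by (simp add: int_pow_int)
    finally have "\<rho> [^] (i - j) \<otimes> \<rho> [^] j = \<rho> [^] j" using \<rho> q by simp
    then show "\<rho> [^] i = \<rho> [^] j" by (simp add: pow_add)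
  qed
  \<comment> \<open>The normal forms contain the identity and are closed under right multiplication
    by the generators, so they exhaust the group.\<close>
  have cover: "carrier G \<subseteq> range (\<lambda>i::int. \<rho> [^] i) \<union> range (\<lambda>i::int. \<rho> [^] i \<otimes> \<sigma>)" (is "_ \<subseteq> ?N")
  proof (rule gen)
    show "\<one> \<in> ?N" by (metis UnI1 int_pow_0 rangeI)
    fix x assume "x \<in> ?N"
    then show "x \<otimes> \<rho> \<in> ?N \<and> x \<otimes> inv \<rho> \<in> ?N \<and> x \<otimes> \<sigma> \<in> ?N"
    proof
      assume "x \<in> range (\<lambda>i::int. \<rho> [^] i)"
      then obtain i :: int where x: "x = \<rho> [^] i" by auto
      have "x \<otimes> \<rho> = \<rho> [^] (i + 1)" "x \<otimes> inv \<rho> = \<rho> [^] (i + - 1)"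
        using pow_add[of i 1] pow_add[of i "- 1"] \<rho> x by (simp_all add: int_pow_neg)
      then show ?thesis using x by blast
    next
      assume "x \<in> range (\<lambda>i::int. \<rho> [^] i \<otimes> \<sigma>)"
      then obtain i :: int where x: "x = \<rho> [^] i \<otimes> \<sigma>" by auto
      have "x \<otimes> \<rho> = \<rho> [^] (i + - 1) \<otimes> \<sigma>"
        using \<rho> \<sigma> x swap[of 1] pow_add[of i "- 1", symmetric] by (simp add: m_assoc)
      moreover have "x \<otimes> inv \<rho> = \<rho> [^] (i + 1) \<otimes> \<sigma>"
        using \<rho> \<sigma> x pow_add[of i 1, symmetric] by (simp add: m_assoc conj)
      moreover have "x \<otimes> \<sigma> = \<rho> [^] i" using \<rho> \<sigma> x sq by (simp add: m_assoc)
      ultimately show ?thesis by blast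
    qed
  qed
  show ?thesis
  proof
    fix i j :: int
    show "\<rho> [^] i \<otimes> (\<rho> [^] j \<otimes> \<sigma>) = \<rho> [^] (i + j) \<otimes> \<sigma>"
      using \<rho> \<sigma> by (simp add: m_assoc flip: pow_add)
    show "\<rho> [^] i \<otimes> \<sigma> \<otimes> \<rho> [^] j = \<rho> [^] (i - j) \<otimes> \<sigma>"
      using \<rho> \<sigma> pow_add[of i "- j"] by (simp add: m_assoc swap) (simp flip: m_assoc)
    have "\<rho> [^] i \<otimes> \<sigma> \<otimes> (\<rho> [^] j \<otimes> \<sigma>) = \<rho> [^] i \<otimes> (\<sigma> \<otimes> \<rho> [^] j) \<otimes> \<sigma>"
      using \<rho> \<sigma> by (simp add: m_assoc)
    also have "\<dots> = \<rho> [^] i \<otimes> \<rho> [^] (- j) \<otimes> (\<sigma> \<otimes> \<sigma>)" using \<rho> \<sigma> by (simp add: m_assoc swap)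
    finally show "\<rho> [^] i \<otimes> \<sigma> \<otimes> (\<rho> [^] j \<otimes> \<sigma>) = \<rho> [^] (i - j)"
      using \<rho> sq pow_add[of i "- j"] by simp
    show "\<rho> [^] i \<otimes> \<sigma> = \<rho> [^] j \<otimes> \<sigma> \<longleftrightarrow> int n dvd i - j" using \<rho> \<sigma> by (simp add: eq_iff)
    show "\<rho> [^] i \<noteq> \<rho> [^] j \<otimes> \<sigma>"
    proof
      assume "\<rho> [^] i = \<rho> [^] j \<otimes> \<sigma>"
      then have "\<rho> [^] (- j) \<otimes> \<rho> [^] i = \<rho> [^] (- j) \<otimes> \<rho> [^] j \<otimes> \<sigma>" using \<rho> \<sigma> by (simp add: m_assoc)
      then show False using nonrot[of "- j + i"] \<sigma> by (simp add: pow_add)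
    qed
  next
    show "carrier G = range (\<lambda>i::int. \<rho> [^] i) \<union> range (\<lambda>i::int. \<rho> [^] i \<otimes> \<sigma>)"
      using cover \<rho> \<sigma> by auto
  qed (use n pow_add eq_iff in auto)
qed

text \<open>The action of words by left multiplication on \<open>r\<^sup>i s\<^sup>e\<close>, encoded as \<open>(i, e)\<close>,
  detects that the presented group does not collapse.\<close>

fun letter_act :: "dihedral_gen \<times> bool \<Rightarrow> int \<times> bool \<Rightarrow> int \<times> bool" where
  "letter_act (Rot, b) (i, e) = (if b then i + 1 else i - 1, e)"
| "letter_act (Refl, b) (i, e) = (- i, \<not> e)"

definition word_act :: "dihedral_gen gword \<Rightarrow> int \<times> bool \<Rightarrow> int \<times> bool" where
  "word_act w = foldr letter_act w"

lemma word_act_simps [simp]: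
  "word_act [] x = x"
  "word_act (c # w) x = letter_act c (word_act w x)"
  "word_act (u @ v) x = word_act u (word_act v x)"
  by (simp_all add: word_act_def)

text \<open>States carry integer exponents, so the word for the \<open>n\<close>-th power of the
  rotation shifts them by \<open>n\<close>; relators act trivially only up to this
  congruence.\<close>

definition cong_mod :: "nat \<Rightarrow> int \<times> bool \<Rightarrow> int \<times> bool \<Rightarrow> bool" where
  "cong_mod n x y \<longleftrightarrow> int n dvd fst x - fst y \<and> snd x = snd y"

lemma cong_mod_refl [simp]: "cong_mod n x x"
  and cong_mod_sym: "cong_mod n x y \<Longrightarrow> cong_mod n y x"
  by (auto simp: cong_mod_def dvd_diff_commute)

lemma cong_mod_trans: "cong_mod n x y \<Longrightarrow> cong_mod n y z \<Longrightarrow> cong_mod n x z"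
  using dvd_add[of "int n" "fst x - fst y" "fst y - fst z"] by (simp add: cong_mod_def)

lemma cong_mod_letter_act: "cong_mod n x y \<Longrightarrow> cong_mod n (letter_act c x) (letter_act c y)"
  by (cases "(c, x)" rule: letter_act.cases; cases y)
    (auto simp: cong_mod_def dvd_diff_commute)

lemma cong_mod_word_act: "cong_mod n x y \<Longrightarrow> cong_mod n (word_act w x) (word_act w y)"
  by (induction w) (auto intro: cong_mod_letter_act)

lemma word_act_replicate_Rot: "word_act (replicate k (Rot, True)) (i, e) = (i + int k, e)"
  by (induction k) auto

definition dihedral_relators :: "nat \<Rightarrow> (dihedral_gen gword \<times> dihedral_gen gword) set" where
  "dihedral_relators n =
    {(replicate n (Rot, True), []),
     ([(Refl, True), (Refl, True)], []),
     ([(Rot, True), (Refl, True)], [(Refl, True), (Rot, False)])}"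

text \<open>Each relation holds for the action at every state. The right context only changes the
  state, and the left context preserves the congruence.\<close>

lemma pres_eq_word_act:
  "pres_eq (dihedral_relators n) u v \<Longrightarrow> cong_mod n (word_act u x) (word_act v x)"
proof (induction arbitrary: x rule: pres_eq.induct)
  case (cancel u c b v)
  have "letter_act (c, b) (letter_act (c, \<not> b) y) = y" for y
    by (cases y; cases c) auto
  then show ?case by simp
next
  case (relator l r u v)
  have "cong_mod n (word_act l y) (word_act r y)" for y
    using relator by (cases y) (auto simp: dihedral_relators_def word_act_replicate_Rot cong_mod_def)
  then show ?case by (simp add: cong_mod_word_act)
next
  case (trans u v w)
  show ?case using trans.IH by (rule cong_mod_trans)
qed (auto intro: cong_mod_sym)

lemma dihedral_dihedral_group:
  assumes n: "n > 0"
  shows "\<exists>rot refl. dihedral (dihedral_group n) n rot refl"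
proof -
  define R where "R = dihedral_relators n"
  define cls where "cls w = pres_rel R `` {w}" for w
  define G where "G = dihedral_group n"
  have G: "G = presented_group R" by (simp add: G_def R_def dihedral_group_def dihedral_relators_def)
  interpret group G unfolding G by (rule group_presented_group)
  have carrier: "carrier G = range cls" and one: "\<one>\<^bsub>G\<^esub> = cls []"
    by (auto simp: G presented_group_def quotient_def cls_def)
  have mult: "cls u \<otimes>\<^bsub>G\<^esub> cls v = cls (u @ v)" for u v
    by (simp add: G cls_def presented_group_mult)
  have cls_eq: "cls u = cls v \<longleftrightarrow> pres_eq R u v" for u v by (simp add: cls_def pres_class_eq_iff)
  have closed: "cls w \<in> carrier G" for w by (simp add: carrier)
  have relator: "cls l = cls r" if "(l, r) \<in> R" for l r
    using pres_eq.relator[OF that, of "[]" "[]"] by (simp add: cls_eq)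
  define \<rho> where "\<rho> = cls [(Rot, True)]"
  define \<sigma> where "\<sigma> = cls [(Refl, True)]"
  have inv: "inv\<^bsub>G\<^esub> (cls [(c, True)]) = cls [(c, False)]" for c
    using pres_eq.cancel[of R "[]" c False "[]"]
    by (intro inv_equality) (simp_all add: mult one cls_eq closed)
  have pow: "\<rho> [^]\<^bsub>G\<^esub> k = cls (replicate k (Rot, True))" for k :: nat
    by (induction k) (simp_all add: one \<rho>_def mult replicate_append_same)
  have sq: "\<sigma> \<otimes>\<^bsub>G\<^esub> \<sigma> = \<one>\<^bsub>G\<^esub>"
    unfolding \<sigma>_def mult one by (rule relator) (simp add: R_def dihedral_relators_def)
  have \<sigma>_inv: "cls [(Refl, False)] = \<sigma>"
    using inv_equality[OF sq] inv[of Refl] closed by (simp add: \<sigma>_def)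
  \<comment> \<open>Each power of \<open>\<rho>\<close> has a representing word that acts by
    translation by \<open>i\<close>, so equations between group elements can be tested on
    states.\<close>
  have word: "\<exists>w. \<rho> [^]\<^bsub>G\<^esub> i = cls w \<and> (\<forall>x. word_act w x = (fst x + i, snd x))" for i :: int
  proof (induction i rule: int_induct[of _ 0])
    case base
    show ?case by (rule exI[of _ "[]"]) (simp add: one)
  next
    case (step1 i)
    then obtain w where w: "\<rho> [^]\<^bsub>G\<^esub> i = cls w" "\<forall>x. word_act w x = (fst x + i, snd x)" by auto
    have "\<rho> [^]\<^bsub>G\<^esub> (i + 1) = \<rho> [^]\<^bsub>G\<^esub> (1 + i)" by (simp add: add.commute)
    also have "\<dots> = \<rho> \<otimes>\<^bsub>G\<^esub> \<rho> [^]\<^bsub>G\<^esub> i"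
      using closed by (subst int_pow_mult) (simp_all add: \<rho>_def)
    also have "\<dots> = cls ((Rot, True) # w)" unfolding w by (simp add: \<rho>_def mult)
    finally show ?case using w by (intro exI[of _ "(Rot, True) # w"]) simp
  next
    case (step2 i)
    then obtain w where w: "\<rho> [^]\<^bsub>G\<^esub> i = cls w" "\<forall>x. word_act w x = (fst x + i, snd x)" by auto
    have "\<rho> [^]\<^bsub>G\<^esub> (i - 1) = \<rho> [^]\<^bsub>G\<^esub> (- 1 + i)" by simp
    also have "\<dots> = inv\<^bsub>G\<^esub> \<rho> \<otimes>\<^bsub>G\<^esub> \<rho> [^]\<^bsub>G\<^esub> i"
      using closed by (subst int_pow_mult) (simp_all add: \<rho>_def int_pow_neg)
    also have "\<dots> = cls ((Rot, False) # w)" unfolding w by (simp add: \<rho>_def mult inv)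
    finally show ?case using w by (intro exI[of _ "(Rot, False) # w"]) simp
  qed
  have "dihedral G n (\<lambda>i. \<rho> [^]\<^bsub>G\<^esub> i) (\<lambda>i. \<rho> [^]\<^bsub>G\<^esub> i \<otimes>\<^bsub>G\<^esub> \<sigma>)"
  proof (rule dihedralI[OF n])
    show \<rho>G: "\<rho> \<in> carrier G" and \<sigma>G: "\<sigma> \<in> carrier G" by (simp_all add: \<rho>_def \<sigma>_def closed)
    show "\<rho> [^]\<^bsub>G\<^esub> n = \<one>\<^bsub>G\<^esub>"
      unfolding pow one by (rule relator) (simp add: R_def dihedral_relators_def)
    show "\<sigma> \<otimes>\<^bsub>G\<^esub> \<sigma> = \<one>\<^bsub>G\<^esub>" by (rule sq)
    show conj: "\<rho> \<otimes>\<^bsub>G\<^esub> \<sigma> = \<sigma> \<otimes>\<^bsub>G\<^esub> inv\<^bsub>G\<^esub> \<rho>"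
      unfolding \<rho>_def \<sigma>_def inv mult by (rule relator) (simp add: R_def dihedral_relators_def)
    show "int n dvd i" if "\<rho> [^]\<^bsub>G\<^esub> i = \<one>\<^bsub>G\<^esub>" for i :: int
    proof -
      obtain w where w: "\<rho> [^]\<^bsub>G\<^esub> i = cls w" "\<forall>x. word_act w x = (fst x + i, snd x)"
        using word by blast
      then have "pres_eq R w []" using that by (simp add: one flip: cls_eq)
      \<comment> \<open>The word \<open>w\<close> sends this state to \<open>(i, False)\<close> and
        the empty word fixes it.\<close>
      from pres_eq_word_act[OF this[unfolded R_def], of "(0, False)"]
      show ?thesis using w by (simp add: cong_mod_def)
    qed
    show "\<rho> [^]\<^bsub>G\<^esub> i \<noteq> \<sigma>" for i :: int
    proof
      assume eq: "\<rho> [^]\<^bsub>G\<^esub> i = \<sigma>"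
      obtain w where w: "\<rho> [^]\<^bsub>G\<^esub> i = cls w" "\<forall>x. word_act w x = (fst x + i, snd x)"
        using word by blast
      then have "pres_eq R w [(Refl, True)]" using eq by (simp add: \<sigma>_def flip: cls_eq)
      \<comment> \<open>The reflection letter flips the flag, whereas \<open>w\<close> keeps
        it.\<close>
      from pres_eq_word_act[OF this[unfolded R_def], of "(0, False)"]
      show False using w by (simp add: cong_mod_def)
    qed
    show "carrier G \<subseteq> N" if "\<one>\<^bsub>G\<^esub> \<in> N"
      and step: "\<And>x. x \<in> N \<Longrightarrow> x \<otimes>\<^bsub>G\<^esub> \<rho> \<in> N \<and> x \<otimes>\<^bsub>G\<^esub> inv\<^bsub>G\<^esub> \<rho> \<in> N \<and> x \<otimes>\<^bsub>G\<^esub> \<sigma> \<in> N" for N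
    proof -
      have "cls w \<in> N" for w
      proof (induction w rule: rev_induct)
        case Nil
        then show ?case using \<open>\<one>\<^bsub>G\<^esub> \<in> N\<close> by (simp add: one)
      next
        case (snoc c w)
        \<comment> \<open>Four letters give only three cases, because the reflection is its own
          inverse.\<close>
        have "cls [c] \<in> {\<rho>, inv\<^bsub>G\<^esub> \<rho>, \<sigma>}"
        proof (cases c)
          case (Pair g b)
          then show ?thesis using \<sigma>_inv by (cases g; cases b) (auto simp: \<rho>_def \<sigma>_def inv)
        qed
        then show ?case using step[OF snoc] mult[of w "[c]", symmetric] by auto
      qed
      then show ?thesis by (auto simp: carrier)
    qed
  qed
  then show ?thesis unfolding G_def by blast
qed

theorem theorem1p9:
  fixes n :: nat
  assumes "n > 0"
  shows "(odd n \<longrightarrow> real (f2 (dihedral_group n)) = 2 ^ prime_omega n - 1) \<and>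
    (even n \<and> n \<noteq> 2 \<longrightarrow>
      real (f2 (dihedral_group n)) =
        2 ^ prime_omega n + 2 powi (int (prime_omega (n div 2)) - 1)
        + real (prime_omega (n div 2)) - real (prime_omega n) - 1) \<and>
    (n = 2 \<longrightarrow> f2 (dihedral_group n) = 1)"
proof -
  obtain rot refl where "dihedral (dihedral_group n) n rot refl"
    using dihedral_dihedral_group[OF assms] by blast
  then show ?thesis by (rule dihedral.f2_formula)
qed

end
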